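(* Let $n$ be a positive integer and let $W\subseteq R_{(1,n)}$ be a basepoint free subspace of dimension three. Then $\mathbb P(W)\cap\Sigma_{1,n}$ is a smooth conic if and only if $I_W$ has a first syzygy of bidegree $(3,n)$.
   Context: $\mathbb K$ is a field, and $R=\mathbb K[s,t;u,v]$ is $\mathbb Z^2$-graded with $\deg s=\deg t=(1,0)$, $\deg u=\deg v=(0,1)$. For $W=\operatorname{Span}\{f_0,f_1,f_2\}$, $I_W=\langle f_0,f_1,f_2\rangle$; $W$ is basepoint free if $\sqrt{I_W}=\langle s,t\rangle\cap\langle u,v\rangle$. $\Sigma_{1,n}\subset\mathbb P(R_{(1,n)})=\mathbb P^{2n+1}$ is the Segre variety of factorizable polynomials, i.e. the image of $\mathbb P(R_{(1,0)})\times\mathbb P(R_{(0,n)})=\mathbb P^1\times\mathbb P^n$ under multiplication $(l,g)\mapsto lg$. A first syzygy of bidegree $(3,n)$ is a nonzero triple $(c_0,c_1,c_2)$ of polynomials, each zero or of bidegree $(2,0)$, with $c_0f_0+c_1f_1+c_2f_2=0$. *)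

theory Defs
  imports
    "HOL-Library.Poly_Mapping"
    "HOL-Algebra.Algebraic_Closure_Type"
begin

datatype var = Var_s | Var_t | Var_u | Var_v

text \<open>Monomials are exponent vectors; a polynomial maps monomials to coefficients.\<close>

type_synonym 'a bipoly = "(var \<Rightarrow>\<^sub>0 nat) \<Rightarrow>\<^sub>0 'a"

definition Xvar :: "var \<Rightarrow> 'a::field bipoly" where
  "Xvar x = Poly_Mapping.single (Poly_Mapping.single x 1) 1"

definition smul :: "'a::field \<Rightarrow> 'a bipoly \<Rightarrow> 'a bipoly" where
  "smul c p = Poly_Mapping.single 0 c * p"

global_interpretation RV: vector_space smul
  by unfold_locales (simp_all add: smul_def algebra_simps single_add mult_single
    flip: mult.assoc)

text \<open>The homogeneous component \<open>R\<^sub>(\<^sub>a\<^sub>,\<^sub>b\<^sub>)\<close>, which contains 0.\<close>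

definition bihom :: "nat \<Rightarrow> nat \<Rightarrow> 'a::field bipoly set" where
  "bihom a b = {p. \<forall>m\<in>Poly_Mapping.keys p.
     Poly_Mapping.lookup m Var_s + Poly_Mapping.lookup m Var_t = a \<and>
     Poly_Mapping.lookup m Var_u + Poly_Mapping.lookup m Var_v = b}"

definition ideal_gen :: "'a::field bipoly set \<Rightarrow> 'a bipoly set" where
  "ideal_gen = Modules.module.span (*)"

definition radical :: "'a::field bipoly set \<Rightarrow> 'a bipoly set" where
  "radical I = {p. \<exists>k. p ^ k \<in> I}"

definition basepoint_free :: "'a::field bipoly set \<Rightarrow> bool" where
  "basepoint_free F \<longleftrightarrow>
     radical (ideal_gen F) = ideal_gen {Xvar Var_s, Xvar Var_t} \<inter> ideal_gen {Xvar Var_u, Xvar Var_v}"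

definition first_syzygy_2_0 :: "'a::field bipoly \<Rightarrow> 'a bipoly \<Rightarrow> 'a bipoly \<Rightarrow> 'a bipoly \<Rightarrow> 'a bipoly \<Rightarrow> 'a bipoly \<Rightarrow> bool" where
  "first_syzygy_2_0 f0 f1 f2 c0 c1 c2 \<longleftrightarrow>
     c0 \<in> bihom 2 0 \<and> c1 \<in> bihom 2 0 \<and> c2 \<in> bihom 2 0 \<and>
     (c0, c1, c2) \<noteq> (0, 0, 0) \<and> c0 * f0 + c1 * f1 + c2 * f2 = 0"

text \<open>
  When \<open>f0\<close>, \<open>f1\<close>, \<open>f2\<close> have bidegree (1,n), a syzygy with coefficients of bidegree (2,0)
  lives in total bidegree (3,n).
\<close>

definition has_first_syzygy_3_n :: "'a::field bipoly \<Rightarrow> 'a bipoly \<Rightarrow> 'a bipoly \<Rightarrow> bool" where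
  "has_first_syzygy_3_n f0 f1 f2 \<longleftrightarrow> (\<exists>c0 c1 c2. first_syzygy_2_0 f0 f1 f2 c0 c1 c2)"

text \<open>A point of the projective space of a vector space is the line spanned by a nonzero vector.\<close>

definition proj_point :: "'a::field bipoly \<Rightarrow> 'a bipoly set" where
  "proj_point p = RV.span {p}"

definition proj_space :: "'a::field bipoly set \<Rightarrow> 'a bipoly set set" where
  "proj_space V = proj_point ` (V - {0})"

definition segre :: "nat \<Rightarrow> 'a::field bipoly set set" where
  "segre n = {proj_point (l * g) | l g. l \<in> bihom 1 0 - {0} \<and> g \<in> bihom 0 n - {0}}"

text \<open>
  Since K need not be algebraically closed, projective varieties over K are identified with
  their sets of geometric points, i.e. points over the algebraic closure.
\<close>

definition base_change :: "'a::field bipoly \<Rightarrow> 'a alg_closure bipoly" where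
  "base_change p = Poly_Mapping.map to_ac p"

definition proj_geom :: "'a::field bipoly set \<Rightarrow> 'a alg_closure bipoly set set" where
  "proj_geom W = proj_space (RV.span (base_change ` W))"

definition quad_form ::
  "'a::field \<Rightarrow> 'a \<Rightarrow> 'a \<Rightarrow> 'a \<Rightarrow> 'a \<Rightarrow> 'a \<Rightarrow> 'a \<Rightarrow> 'a \<Rightarrow> 'a \<Rightarrow> 'a" where
  "quad_form a b c d e h x y z = a*x^2 + b*y^2 + c*z^2 + d*x*y + e*x*z + h*y*z"

text \<open>
  Singular zeros of the form: the form and its three partial derivatives vanish. In
  characteristic 2 the vanishing of the form is not implied by that of its derivatives.
\<close>

definition singular_zero ::
  "'a::field \<Rightarrow> 'a \<Rightarrow> 'a \<Rightarrow> 'a \<Rightarrow> 'a \<Rightarrow> 'a \<Rightarrow> 'a \<Rightarrow> 'a \<Rightarrow> 'a \<Rightarrow> bool" where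
  "singular_zero a b c d e h x y z \<longleftrightarrow>
     quad_form a b c d e h x y z = 0 \<and>
     2*a*x + d*y + e*z = 0 \<and> 2*b*y + d*x + h*z = 0 \<and> 2*c*z + e*x + h*y = 0"

text \<open>
  \<open>C\<close> is the set of geometric points of a smooth conic defined over K in the projective plane
  with homogeneous coordinates given by the linearly independent \<open>f0\<close>, \<open>f1\<close>, \<open>f2\<close>. Smoothness
  is tested at all geometric points by the Jacobian criterion; it forces the form to be nonzero.
\<close>

definition smooth_conic :: "'a::field bipoly \<Rightarrow> 'a bipoly \<Rightarrow> 'a bipoly \<Rightarrow> 'a alg_closure bipoly set set \<Rightarrow> bool" where
  "smooth_conic f0 f1 f2 C \<longleftrightarrow>
     (\<exists>a b c d e h :: 'a.
        (\<forall>x y z. (x, y, z) \<noteq> (0, 0, 0) \<longrightarrow>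
           \<not> singular_zero (to_ac a) (to_ac b) (to_ac c) (to_ac d) (to_ac e) (to_ac h) x y z) \<and>
        C = {proj_point (smul x (base_change f0) + smul y (base_change f1) + smul z (base_change f2))
              | x y z. (x, y, z) \<noteq> (0, 0, 0) \<and>
                quad_form (to_ac a) (to_ac b) (to_ac c) (to_ac d) (to_ac e) (to_ac h) x y z = 0})"

end

theory Submission
  imports
    Defs
    "HOL-Analysis.Cartesian_Space"
begin

text \<open>
  Write \<open>f\<^sub>i = s a\<^sub>i + t b\<^sub>i\<close> with \<open>a\<^sub>i, b\<^sub>i\<close> forms of degree \<open>n\<close> in \<open>u, v\<close>. This turns
  \<open>W\<close> into a pencil of linear maps \<open>a, b\<close> from three-space to binary forms. The member of \<open>W\<close>
  with coordinates \<open>x\<close> factors as a linear form in \<open>s, t\<close> times a form in \<open>u, v\<close> exactly when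
  \<open>\<sigma> a(x) + \<tau> b(x) = 0\<close> for some \<open>(\<sigma>,\<tau>) \<noteq> (0,0)\<close>; such \<open>x\<close> are called degenerate below
  (lemma \<open>mem_segre_iff\<close>). A syzygy of bidegree \<open>(3,n)\<close> is the same as a point
  \<open>C(s,t) = s\<^sup>2 C\<^sub>0 + s t C\<^sub>1 + t\<^sup>2 C\<^sub>2\<close> with \<open>s a(C(s,t)) + t b(C(s,t)) = 0\<close> identically, so its
  values are degenerate points moving along a curve.

  Base points are excluded only in the form: no geometric point \<open>(s,t;u,v)\<close> is a common zero
  of the \<open>f\<^sub>i\<close>. A family of linear functionals on three-space that all kill a plane consists of
  multiples of one functional, and a binary form of positive degree has a root; hence a
  two-dimensional kernel of \<open>\<sigma> a + \<tau> b\<close>, and likewise a syzygy of degree one in \<open>s, t\<close>, would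
  produce a base point (\<open>kernel_at_most_line\<close>, \<open>no_linear_syzygy\<close>).

  If a syzygy exists, the absence of syzygies of lower degree forces \<open>C\<^sub>0, C\<^sub>1, C\<^sub>2\<close> to be
  independent, as for a minimal index of a pencil of matrices. In the coordinates dual to them
  the points \<open>C(s,t)\<close> form the smooth conic \<open>y\<^sup>2 = x z\<close>, and because kernels are at most lines
  there are no further degenerate points (\<open>degenerate_iff_conic\<close>).

  Conversely, a smooth conic over the algebraic closure is parametrized by
  \<open>G(y,z) = y\<^sup>2 G\<^sub>0 + y z G\<^sub>1 + z\<^sup>2 G\<^sub>2\<close> with independent \<open>G\<^sub>i\<close>. If all its points are degenerate,
  then \<open>a(G(y,z))\<close> and \<open>b(G(y,z))\<close> are proportional for all \<open>y, z\<close>. After a linear change of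
  \<open>s, t\<close> that makes \<open>a(G\<^sub>0) = 0\<close> and \<open>b(G\<^sub>2) = 0\<close>, comparing coefficients in this proportionality
  gives \<open>y a(G(y,z)) = l z b(G(y,z))\<close> for a nonzero constant \<open>l\<close>, which is a syzygy of the required
  degree (\<open>syzygy_of_degenerate_conic\<close>). Its coefficients lie in the algebraic closure, but they
  solve a linear system over the ground field, so a linear functional from the closure to the
  ground field carries them to a nonzero solution there.
\<close>

no_notation fps_nth (infixl \<open>$\<close> 75)

section \<open>Binary forms and linear algebra in three-space\<close>

text \<open>Over a finite field the polynomial \<open>\<Prod>\<^sub>a (X - a) + 1\<close> is nonconstant and has no root.\<close>

lemma infinite_alg_closed: "infinite (UNIV :: 'b::alg_closed_field set)"
proof
  assume fin: "finite (UNIV :: 'b set)"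
  define p :: "'b poly" where "p = (\<Prod>a\<in>UNIV. [:- a, 1:])"
  have "degree p = card (UNIV :: 'b set)"
    unfolding p_def by (subst degree_prod_eq_sum_degree) auto
  then have "degree (p + 1) > 0"
    using fin by (subst degree_add_eq_left) (auto simp: card_gt_0_iff)
  then obtain x where "poly (p + 1) x = 0"
    using alg_closed_imp_poly_has_root by blast
  moreover have "poly p x = 0"
    using fin by (simp add: p_def poly_prod prod_zero_iff)
  ultimately show False by simp
qed

definition binary_form :: "(nat \<Rightarrow> 'b::field) \<Rightarrow> nat \<Rightarrow> 'b \<Rightarrow> 'b \<Rightarrow> 'b" where
  "binary_form g n u v = (\<Sum>k\<le>n. g k * u ^ k * v ^ (n - k))"

lemma binary_form_scale: "binary_form (\<lambda>k. c * g k) n u v = c * binary_form g n u v"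
  by (simp add: binary_form_def sum_distrib_left mult.assoc)

lemma binary_form_coeff_0 [simp]: "binary_form (coeff 0) n u v = 0"
  by (simp add: binary_form_def)

lemma binary_form_coeff_add [simp]: "binary_form (coeff (p + q)) n u v = binary_form (coeff p) n u v + binary_form (coeff q) n u v"
  by (simp add: binary_form_def algebra_simps sum.distrib)

lemma binary_form_coeff_smult [simp]: "binary_form (coeff (smult c p)) n u v = c * binary_form (coeff p) n u v"
  by (simp add: binary_form_def sum_distrib_left mult.assoc)

lemma binary_form_coeff_minus [simp]: "binary_form (coeff (- p)) n u v = - binary_form (coeff p) n u v"
  by (simp add: binary_form_def sum_negf)

text \<open>If the coefficient of \<open>u\<^sup>n\<close> vanishes, the root is the point at infinity \<open>(1,0)\<close>; otherwise
  setting \<open>v = 1\<close> leaves a polynomial of degree exactly \<open>n\<close>.\<close>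

lemma binary_form_has_root:
  fixes g :: "nat \<Rightarrow> 'b::alg_closed_field"
  assumes "n > 0"
  shows "\<exists>u v. (u, v) \<noteq> (0, 0) \<and> binary_form g n u v = 0"
proof (cases "g n = 0")
  case True
  have "binary_form g n 1 0 = g n"
  proof -
    have "binary_form g n 1 0 = (\<Sum>k\<le>n. if k = n then g k else 0)"
      unfolding binary_form_def by (rule sum.cong) (auto simp: power_0_left)
    then show ?thesis by simp
  qed
  with True show ?thesis by (metis prod.inject zero_neq_one)
next
  case False
  then obtain x where "(\<Sum>k\<le>n. g k * x ^ k) = 0"
    using alg_closed[OF assms] by blast
  then have "binary_form g n x 1 = 0" by (simp add: binary_form_def)
  then show ?thesis by (metis prod.inject zero_neq_one)
qed

lemma independent_triple_spans:
  fixes A B C v :: "'b::field^3"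
  assumes "\<And>x y z. x *s A + y *s B + z *s C = 0 \<Longrightarrow> x = 0 \<and> y = 0 \<and> z = 0"
  shows "\<exists>x y z. v = x *s A + y *s B + z *s C"
proof -
  define T where "T w = w$1 *s A + w$2 *s B + w$3 *s C" for w :: "'b^3"
  have lin: "Vector_Spaces.linear (*s) (*s) T"
    unfolding Vector_Spaces.linear_iff T_def
    by (auto simp: vec.vector_space_axioms vec_eq_iff algebra_simps)
  have "inj T"
  proof (rule injI)
    fix p q assume "T p = T q"
    then have "(p$1 - q$1) *s A + (p$2 - q$2) *s B + (p$3 - q$3) *s C = 0"
      by (simp add: T_def vec_eq_iff algebra_simps)
    from assms[OF this] show "p = q" by (simp add: vec_eq_iff forall_3)
  qed
  with lin have "surj T" by (rule vec.linear_inj_imp_surj)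
  then obtain w where "v = T w" by blast
  then show ?thesis unfolding T_def by blast
qed

lemma independent_pair_extends:
  fixes A B :: "'b::field^3"
  assumes ind: "\<And>x y. x *s A + y *s B = 0 \<Longrightarrow> x = 0 \<and> y = 0"
  shows "\<exists>E. (\<forall>x y z. x *s A + y *s B + z *s E = 0 \<longrightarrow> x = 0 \<and> y = 0 \<and> z = 0) \<and>
    (\<forall>v. \<exists>x y z. v = x *s A + y *s B + z *s E)"
proof -
  have "vec.dim (vec.span {A, B}) \<le> card {A, B}"
    by (rule vec.dim_le_card) auto
  also have "\<dots> \<le> 2" by (simp add: card_insert_if)
  finally have "vec.dim (vec.span {A, B}) \<noteq> vec.dim (UNIV :: ('b^3) set)"
    unfolding vec_dim_card by simp
  then have "vec.span {A, B} \<noteq> UNIV" by metis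
  then obtain E where E: "E \<notin> vec.span {A, B}" by blast
  have "x = 0 \<and> y = 0 \<and> z = 0" if h: "x *s A + y *s B + z *s E = 0" for x y z
  proof -
    have "z = 0"
    proof (rule ccontr)
      assume z: "z \<noteq> 0"
      have "E = (- x / z) *s A + (- y / z) *s B"
        using h z by (simp add: vec_eq_iff field_simps) (metis add.commute add_eq_0_iff)
      also have "\<dots> \<in> vec.span {A, B}"
        by (intro vec.span_add vec.span_scale vec.span_base) auto
      finally show False using E by blast
    qed
    with h ind show ?thesis by simp
  qed
  then show ?thesis using independent_triple_spans[of A B E] by blast
qed

text \<open>The functionals \<open>\<psi> k\<close> factor through the one-dimensional quotient by the plane that \<open>A\<close> and \<open>B\<close>
  span, so the binary forms \<open>\<Sum>\<^sub>k \<psi>\<^sub>k(x) u\<^sup>k v\<^sup>n\<^sup>-\<^sup>k\<close> are, for all \<open>x\<close>, multiples of a single one, and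
  they share its root. Both uses of base point freeness below go through this lemma, once with the
  binary variables \<open>u, v\<close> and once with \<open>s, t\<close>.\<close>

lemma rank_one_family_has_root:
  fixes \<psi> :: "nat \<Rightarrow> 'b::alg_closed_field^3 \<Rightarrow> 'b"
  assumes "n > 0"
    and add: "\<And>k x y. \<psi> k (x + y) = \<psi> k x + \<psi> k y"
    and scale: "\<And>k c x. \<psi> k (c *s x) = c * \<psi> k x"
    and ind: "\<And>x y. x *s A + y *s B = 0 \<Longrightarrow> x = 0 \<and> y = 0"
    and ker: "\<And>k. k \<le> n \<Longrightarrow> \<psi> k A = 0" "\<And>k. k \<le> n \<Longrightarrow> \<psi> k B = 0"
  shows "\<exists>u v. (u, v) \<noteq> (0, 0) \<and> (\<forall>x. binary_form (\<lambda>k. \<psi> k x) n u v = 0)"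
proof -
  obtain E where E: "\<And>v. \<exists>x y z. v = x *s A + y *s B + z *s E"
    using independent_pair_extends[OF ind] by blast
  obtain u v where uv: "(u, v) \<noteq> (0, 0)" "binary_form (\<lambda>k. \<psi> k E) n u v = 0"
    using binary_form_has_root[OF \<open>n > 0\<close>] by blast
  have "binary_form (\<lambda>k. \<psi> k w) n u v = 0" for w
  proof -
    obtain x y z where w: "w = x *s A + y *s B + z *s E" using E by blast
    have "binary_form (\<lambda>k. \<psi> k w) n u v = binary_form (\<lambda>k. z * \<psi> k E) n u v"
      unfolding binary_form_def by (rule sum.cong) (auto simp: w add scale ker)
    then show ?thesis by (simp add: binary_form_scale uv)
  qed
  with uv show ?thesis by blast
qed

section \<open>Pencils of linear maps on three-space\<close>

definition lincomb :: "(3 \<Rightarrow> 'b::field poly) \<Rightarrow> 'b^3 \<Rightarrow> 'b poly" where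
  "lincomb \<alpha> x = (\<Sum>i\<in>UNIV. smult (x$i) (\<alpha> i))"

lemma lincomb_add [simp]: "lincomb \<alpha> (x + y) = lincomb \<alpha> x + lincomb \<alpha> y"
  by (simp add: lincomb_def smult_add_left sum.distrib)

lemma lincomb_scale [simp]: "lincomb \<alpha> (c *s x) = smult c (lincomb \<alpha> x)"
  by (rule poly_eqI) (simp add: lincomb_def coeff_sum sum_distrib_left mult.assoc)

lemma lincomb_0 [simp]: "lincomb \<alpha> 0 = 0"
  by (simp add: lincomb_def)

definition quadratic_point :: "'b::field^3 \<Rightarrow> 'b^3 \<Rightarrow> 'b^3 \<Rightarrow> 'b \<Rightarrow> 'b \<Rightarrow> 'b^3" where
  "quadratic_point C0 C1 C2 s t = s\<^sup>2 *s C0 + (s * t) *s C1 + t\<^sup>2 *s C2"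

text \<open>The coefficients of \<open>s\<^sup>3, s\<^sup>2t, st\<^sup>2, t\<^sup>3\<close> in \<open>s a(C(s,t)) + t b(C(s,t))\<close> vanish, where
  \<open>C(s,t) = s\<^sup>2 C\<^sub>0 + s t C\<^sub>1 + t\<^sup>2 C\<^sub>2\<close>. Stating this through coefficients keeps the notion meaningful
  over finite fields, where values at points do not determine a polynomial.\<close>

definition quadratic_syzygy ::
  "(3 \<Rightarrow> 'b::field poly) \<Rightarrow> (3 \<Rightarrow> 'b poly) \<Rightarrow> 'b^3 \<Rightarrow> 'b^3 \<Rightarrow> 'b^3 \<Rightarrow> bool" where
  "quadratic_syzygy \<alpha> \<beta> C0 C1 C2 \<longleftrightarrow>
     lincomb \<alpha> C0 = 0 \<and> lincomb \<beta> C0 + lincomb \<alpha> C1 = 0 \<and>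
     lincomb \<beta> C1 + lincomb \<alpha> C2 = 0 \<and> lincomb \<beta> C2 = 0 \<and>
     \<not> (C0 = 0 \<and> C1 = 0 \<and> C2 = 0)"

text \<open>For \<open>t = 1\<close> each coefficient is a cubic polynomial in \<open>s\<close> that vanishes on an infinite field.\<close>

lemma quadratic_syzygyI_pointwise:
  fixes \<alpha> \<beta> :: "3 \<Rightarrow> 'b::alg_closed_field poly"
  assumes "\<And>s t. smult s (lincomb \<alpha> (quadratic_point C0 C1 C2 s t)) +
      smult t (lincomb \<beta> (quadratic_point C0 C1 C2 s t)) = 0"
    and "\<not> (C0 = 0 \<and> C1 = 0 \<and> C2 = 0)"
  shows "quadratic_syzygy \<alpha> \<beta> C0 C1 C2"
proof -
  define a where "a C k = coeff (lincomb \<alpha> C) k" for C k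
  define b where "b C k = coeff (lincomb \<beta> C) k" for C k
  have z: "[:b C2 k, b C1 k + a C2 k, b C0 k + a C1 k, a C0 k:] = 0" for k
  proof (rule ccontr)
    assume nz: "[:b C2 k, b C1 k + a C2 k, b C0 k + a C1 k, a C0 k:] \<noteq> 0" (is "?p \<noteq> 0")
    have "poly ?p s = 0" for s
      using arg_cong[OF assms(1)[of s 1], of "\<lambda>p. coeff p k"]
      by (simp add: quadratic_point_def a_def b_def algebra_simps power2_eq_square)
    then have "{s. poly ?p s = 0} = UNIV" by blast
    with poly_roots_finite[OF nz] infinite_alg_closed show False by metis
  qed
  have "b C2 k = 0" "b C1 k + a C2 k = 0" "b C0 k + a C1 k = 0" "a C0 k = 0" for k
    using z[of k] by simp_all
  then show ?thesis
    unfolding quadratic_syzygy_def using assms(2) by (auto simp: a_def b_def intro!: poly_eqI)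
qed

lemma quadratic_syzygy_pointwise:
  assumes "quadratic_syzygy \<alpha> \<beta> C0 C1 C2"
  shows "smult s (lincomb \<alpha> (quadratic_point C0 C1 C2 s t)) +
      smult t (lincomb \<beta> (quadratic_point C0 C1 C2 s t)) = 0"
proof -
  have e: "lincomb \<alpha> C0 = 0" "lincomb \<alpha> C1 = - lincomb \<beta> C0"
    "lincomb \<alpha> C2 = - lincomb \<beta> C1" "lincomb \<beta> C2 = 0"
    using assms by (auto simp: quadratic_syzygy_def eq_neg_iff_add_eq_0 add.commute)
  show ?thesis
    by (rule poly_eqI) (simp add: quadratic_point_def e algebra_simps power2_eq_square)
qed

text \<open>Forms of degree \<open>n\<close> in \<open>u, v\<close> are represented by univariate polynomials, the coefficient
  of \<open>X\<^sup>k\<close> standing for that of \<open>u\<^sup>k v\<^sup>n\<^sup>-\<^sup>k\<close>. The second assumption says that the generators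
  of the net are linearly independent, the third that they have no common zero in the product of two
  projective lines.\<close>

locale pencil =
  fixes \<alpha> \<beta> :: "3 \<Rightarrow> 'b::alg_closed_field poly" and n :: nat
  assumes n_pos: "n > 0"
    and injective: "lincomb \<alpha> x = 0 \<Longrightarrow> lincomb \<beta> x = 0 \<Longrightarrow> x = 0"
    and no_base_point: "(s, t) \<noteq> (0, 0) \<Longrightarrow> (u, v) \<noteq> (0, 0) \<Longrightarrow>
      \<exists>x. s * binary_form (coeff (lincomb \<alpha> x)) n u v + t * binary_form (coeff (lincomb \<beta> x)) n u v \<noteq> 0"
begin

abbreviation a where "a \<equiv> lincomb \<alpha>"
abbreviation b where "b \<equiv> lincomb \<beta>"

definition degenerate where
  "degenerate x \<longleftrightarrow> (\<exists>s t. (s, t) \<noteq> (0, 0) \<and> smult s (a x) + smult t (b x) = 0)"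

text \<open>If the kernel of \<open>s a + t b\<close> contained a plane, its values would all be multiples of one
  binary form, and a root of that form would be a base point over \<open>(s,t)\<close>.\<close>

lemma kernel_at_most_line:
  assumes st: "(s, t) \<noteq> (0, 0)"
    and x: "smult s (a x) + smult t (b x) = 0" and y: "smult s (a y) + smult t (b y) = 0"
  shows "\<exists>p q. (p, q) \<noteq> (0, 0) \<and> p *s x + q *s y = 0"
proof (rule ccontr)
  assume ind: "\<not> ?thesis"
  define \<psi> where "\<psi> k w = coeff (smult s (a w) + smult t (b w)) k" for k w
  have "\<exists>u v. (u, v) \<noteq> (0, 0) \<and> (\<forall>w. binary_form (\<lambda>k. \<psi> k w) n u v = 0)"
  proof (rule rank_one_family_has_root[OF n_pos])
    show "p = 0 \<and> q = 0" if "p *s x + q *s y = 0" for p q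
      using ind that by auto
    show "\<psi> k x = 0" "\<psi> k y = 0" for k
      unfolding \<psi>_def x y by simp_all
  qed (simp_all add: \<psi>_def algebra_simps)
  then obtain u v where uv: "(u, v) \<noteq> (0, 0)" "\<And>w. binary_form (\<lambda>k. \<psi> k w) n u v = 0"
    by blast
  from uv(2) show False
    using no_base_point[OF st uv(1)] unfolding \<psi>_def by (simp del: coeff_add coeff_smult)
qed

text \<open>A syzygy of degree one sends \<open>C\<^sub>0\<close> to \<open>t g\<close> and \<open>C\<^sub>1\<close> to \<open>- s g\<close> with the same \<open>g = b(C\<^sub>0)\<close>. At a
  root of \<open>g\<close> these two members of the net vanish for all \<open>s, t\<close>, and any third one is a linear form
  in \<open>s, t\<close>, which has a zero; this is a base point.\<close>

lemma no_linear_syzygy: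
  assumes C0: "a C0 = 0" and C01: "b C0 + a C1 = 0" and C1: "b C1 = 0"
  shows "C0 = 0 \<and> C1 = 0"
proof (rule ccontr)
  assume nz: "\<not> ?thesis"
  have aC1: "a C1 = - b C0" using C01 by (simp add: eq_neg_iff_add_eq_0 add.commute)
  have C0nz: "C0 \<noteq> 0"
  proof
    assume "C0 = 0"
    with aC1 C1 have "C1 = 0" by (intro injective) auto
    with \<open>C0 = 0\<close> nz show False by blast
  qed
  then have bC0: "b C0 \<noteq> 0" using injective C0 by blast
  have ind: "x = 0 \<and> y = 0" if "x *s C0 + y *s C1 = 0" for x y
  proof -
    have "a (x *s C0 + y *s C1) = 0" "b (x *s C0 + y *s C1) = 0" using that by simp_all
    with bC0 show ?thesis unfolding lincomb_add lincomb_scale C0 aC1 C1 by auto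
  qed
  obtain u v where uv: "(u, v) \<noteq> (0, 0)" "binary_form (coeff (b C0)) n u v = 0"
    using binary_form_has_root[OF n_pos] by blast
  \<comment> \<open>Values at the chosen root, as linear forms in \<open>s, t\<close>: index 1 is the coefficient of \<open>s\<close>.\<close>
  define \<psi> where "\<psi> k w = binary_form (coeff (if k = 0 then b w else a w)) n u v" for k :: nat and w
  have "\<exists>t s. (t, s) \<noteq> (0, 0) \<and> (\<forall>w. binary_form (\<lambda>k. \<psi> k w) 1 t s = 0)"
    by (rule rank_one_family_has_root[where A = C0 and B = C1])
      (use ind uv(2) in \<open>auto simp: \<psi>_def C0 C1 aC1\<close>)
  then obtain s t where st: "(s, t) \<noteq> (0, 0)" "\<And>w. binary_form (\<lambda>k. \<psi> k w) 1 s t = 0" by blast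
  have "s * binary_form (coeff (a w)) n u v + t * binary_form (coeff (b w)) n u v = 0" for w
  proof -
    have "binary_form (\<lambda>k. \<psi> k w) 1 s t = \<psi> 1 w * s + \<psi> 0 w * t"
      by (simp add: binary_form_def)
    with st(2)[of w] show ?thesis by (simp add: \<psi>_def algebra_simps)
  qed
  then show False using no_base_point[OF st(1) uv(1)] by blast
qed

text \<open>This is the classical argument for a singular pencil of minimal index: a relation among
  \<open>a(C\<^sub>1)\<close> and \<open>a(C\<^sub>2)\<close> could be used to build a nonzero syzygy of degree one. Since
  \<open>a\<close> kills \<open>C\<^sub>0\<close>, applying it to a relation among all three vectors leaves one between the two
  images, so only a multiple of the nonzero vector \<open>C\<^sub>0\<close> can remain.\<close>

lemma quadratic_syzygy_independent:
  assumes syz: "quadratic_syzygy \<alpha> \<beta> C0 C1 C2" and dep: "x *s C0 + y *s C1 + z *s C2 = 0"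
  shows "x = 0 \<and> y = 0 \<and> z = 0"
proof -
  have aC0: "a C0 = 0" and bC2: "b C2 = 0" and nz: "\<not> (C0 = 0 \<and> C1 = 0 \<and> C2 = 0)"
    and aC1: "a C1 = - b C0" and aC2: "a C2 = - b C1"
    using syz by (auto simp: quadratic_syzygy_def eq_neg_iff_add_eq_0 add.commute)
  have C0: "C0 \<noteq> 0"
  proof
    assume "C0 = 0"
    then have "C1 = 0 \<and> C2 = 0" using aC1 aC2 bC2 by (intro no_linear_syzygy) auto
    with \<open>C0 = 0\<close> nz show False by blast
  qed
  have C2: "C2 \<noteq> 0"
  proof
    assume "C2 = 0"
    then have "C0 = 0 \<and> C1 = 0" using aC0 aC1 aC2 by (intro no_linear_syzygy) auto
    with \<open>C2 = 0\<close> nz show False by blast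
  qed
  have ind: "y = 0 \<and> z = 0" if h: "smult y (a C1) + smult z (a C2) = 0" for y z
  proof -
    have "z = 0"
    proof (rule ccontr)
      assume z: "z \<noteq> 0"
      \<comment> \<open>The pair \<open>(z C\<^sub>2 + y C\<^sub>1, y C\<^sub>2)\<close> would be a syzygy of degree one.\<close>
      have "z *s C2 + y *s C1 = 0 \<and> y *s C2 = 0"
        by (rule no_linear_syzygy)
          (use h in \<open>simp_all add: aC1 aC2 bC2 add.commute smult_minus_right\<close>)
      with C2 z show False by auto
    qed
    moreover have "y = 0"
    proof (rule ccontr)
      assume "y \<noteq> 0"
      then have "b C0 = 0" using h \<open>z = 0\<close> aC1 by simp
      then show False using injective aC0 C0 by blast
    qed
    ultimately show ?thesis by blast
  qed
  have "a (x *s C0 + y *s C1 + z *s C2) = 0" using dep by simp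
  then have "y = 0 \<and> z = 0" by (intro ind) (simp add: aC0)
  with dep C0 show ?thesis by simp
qed

text \<open>The points with \<open>y\<^sup>2 = x z\<close> are the multiples of \<open>C(s,t)\<close>, hence degenerate. Conversely a
  degenerate point lies in the kernel of some \<open>s a + t b\<close>, which is the line through \<open>C(s,t)\<close>.\<close>

lemma degenerate_iff_conic:
  assumes syz: "quadratic_syzygy \<alpha> \<beta> C0 C1 C2"
  shows "degenerate (x *s C0 + y *s C1 + z *s C2) \<longleftrightarrow> y\<^sup>2 = x * z"
proof
  note ind = quadratic_syzygy_independent[OF syz]
  assume "degenerate (x *s C0 + y *s C1 + z *s C2)"
  then obtain s t where st: "(s, t) \<noteq> (0, 0)"
    and w: "smult s (a (x *s C0 + y *s C1 + z *s C2)) +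
      smult t (b (x *s C0 + y *s C1 + z *s C2)) = 0"
    unfolding degenerate_def by blast
  obtain p q where pq: "(p, q) \<noteq> (0, 0)"
    and dep: "p *s (x *s C0 + y *s C1 + z *s C2) + q *s quadratic_point C0 C1 C2 s t = 0"
    using kernel_at_most_line[OF st w quadratic_syzygy_pointwise[OF syz]] by blast
  have "(p * x + q * s\<^sup>2) *s C0 + (p * y + q * (s * t)) *s C1 + (p * z + q * t\<^sup>2) *s C2 = 0"
    using dep by (simp add: quadratic_point_def vec_eq_iff algebra_simps)
  from ind[OF this] have e: "p * x = - q * s\<^sup>2" "p * y = - q * (s * t)" "p * z = - q * t\<^sup>2"
    by (auto simp: eq_neg_iff_add_eq_0)
  have p: "p \<noteq> 0"
  proof
    assume "p = 0"
    with e pq st show False by auto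
  qed
  have "(p * y)\<^sup>2 = (p * x) * (p * z)" unfolding e by (simp add: power2_eq_square)
  then have "p\<^sup>2 * y\<^sup>2 = p\<^sup>2 * (x * z)" by (simp add: power2_eq_square algebra_simps)
  with p show "y\<^sup>2 = x * z" by simp
next
  assume conic: "y\<^sup>2 = x * z"
  show "degenerate (x *s C0 + y *s C1 + z *s C2)"
  proof (cases "x = 0")
    case True
    with conic have "y = 0" by simp
    have "smult 0 (a (z *s C2)) + smult 1 (b (z *s C2)) = 0"
      using syz by (simp add: quadratic_syzygy_def)
    with True \<open>y = 0\<close> show ?thesis unfolding degenerate_def
      by (intro exI[of _ 0] exI[of _ 1]) simp
  next
    case False
    have "quadratic_point C0 C1 C2 x y = x *s (x *s C0 + y *s C1 + z *s C2)"
      unfolding quadratic_point_def conic by (simp add: vec_eq_iff power2_eq_square algebra_simps)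
    then have w: "x *s C0 + y *s C1 + z *s C2 = (1 / x) *s quadratic_point C0 C1 C2 x y"
      using False by (simp only: vector_smult_assoc) simp
    have "smult x (a (quadratic_point C0 C1 C2 x y)) + smult y (b (quadratic_point C0 C1 C2 x y)) = 0"
      by (rule quadratic_syzygy_pointwise[OF syz])
    then have "smult (1 / x) (smult x (a (quadratic_point C0 C1 C2 x y)) + smult y (b (quadratic_point C0 C1 C2 x y))) = 0"
      by simp
    then have "smult x (a (x *s C0 + y *s C1 + z *s C2)) + smult y (b (x *s C0 + y *s C1 + z *s C2)) = 0"
      unfolding w lincomb_scale by (simp add: smult_add_right mult.commute)
    with False show ?thesis unfolding degenerate_def by blast
  qed
qed

end

text \<open>The two-by-two minors of the pair of coefficient vectors; they all vanish exactly when
  the two polynomials are linearly dependent.\<close>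

definition wedge :: "'b::field poly \<Rightarrow> 'b poly \<Rightarrow> nat \<Rightarrow> nat \<Rightarrow> 'b" where
  "wedge p q i j = coeff p i * coeff q j - coeff p j * coeff q i"

lemma wedge_smult_left: "wedge (smult c p) q i j = c * wedge p q i j"
  by (simp add: wedge_def algebra_simps)

lemma wedge_zero_of_relation:
  assumes "smult s p + smult t q = 0" and "(s, t) \<noteq> (0, 0)"
  shows "wedge p q i j = 0"
proof -
  have c: "s * coeff p k + t * coeff q k = 0" for k
    using arg_cong[OF assms(1), of "\<lambda>r. coeff r k"] by simp
  have "s * wedge p q i j = (s * coeff p i + t * coeff q i) * coeff q j - (s * coeff p j + t * coeff q j) * coeff q i"
    "t * wedge p q i j = (s * coeff p j + t * coeff q j) * coeff p i - (s * coeff p i + t * coeff q i) * coeff p j"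
    by (simp_all add: wedge_def algebra_simps)
  with assms(2) show ?thesis by (auto simp: c)
qed

lemma proportional_of_wedge_zero:
  assumes "p \<noteq> 0" and "\<And>i j. wedge p q i j = 0"
  shows "\<exists>c. q = smult c p"
proof -
  define d where "d = degree p"
  have d: "coeff p d \<noteq> 0" using \<open>p \<noteq> 0\<close> by (simp add: d_def)
  have "q = smult (coeff q d / coeff p d) p"
  proof (rule poly_eqI)
    fix k
    have "coeff p d * coeff q k = coeff p k * coeff q d"
      using assms(2)[of d k] by (simp add: wedge_def)
    with d show "coeff q k = coeff (smult (coeff q d / coeff p d) p) k"
      by (simp add: field_simps)
  qed
  then show ?thesis by blast
qed

lemma quadratic_zero_on_units:
  fixes p0 p1 p2 :: "'b::alg_closed_field"
  assumes "\<And>z. z \<noteq> 0 \<Longrightarrow> p0 + p1 * z + p2 * z\<^sup>2 = 0"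
  shows "p0 = 0 \<and> p1 = 0 \<and> p2 = 0"
proof -
  have "[:p0, p1, p2:] = 0"
  proof (rule ccontr)
    assume nz: "[:p0, p1, p2:] \<noteq> 0"
    have "- {0} \<subseteq> {z. poly [:p0, p1, p2:] z = 0}"
      using assms by (auto simp: power2_eq_square algebra_simps)
    then have "finite (- {0 :: 'b})"
      using poly_roots_finite[OF nz] by (rule finite_subset)
    then show False using infinite_alg_closed[where 'b = 'b] by (simp add: finite_compl)
  qed
  then show ?thesis by simp
qed

context pencil
begin

text \<open>Combine \<open>a\<close> and \<open>b\<close> into \<open>a'\<close> and \<open>b'\<close> with \<open>a'(G\<^sub>0) = 0\<close> and \<open>b'(G\<^sub>2) = 0\<close>. Dividing
  \<open>a'(G(1,z))\<close> by \<open>z\<close> leaves \<open>a'(G\<^sub>1) + z a'(G\<^sub>2)\<close>, which has to be proportional to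
  \<open>b'(G\<^sub>0) + z b'(G\<^sub>1)\<close> for every \<open>z \<noteq> 0\<close>. The coefficients of \<open>1, z, z\<^sup>2\<close> in the minors give
  \<open>a'(G\<^sub>1) = l b'(G\<^sub>0)\<close>, \<open>b'(G\<^sub>1) = m a'(G\<^sub>2)\<close>, and either \<open>l m = 1\<close> or \<open>a'(G\<^sub>2)\<close> is a multiple of
  \<open>b'(G\<^sub>0)\<close>. The second alternative confines three independent members of the net to a space of
  dimension two. In the first, the proportionality factor is \<open>l z / y\<close>, of degree one, and
  inverting the change of the parameters \<open>y, z\<close> gives the syzygy.\<close>

lemma syzygy_of_degenerate_conic:
  assumes ind: "\<And>x y z. x *s G0 + y *s G1 + z *s G2 = 0 \<Longrightarrow> x = 0 \<and> y = 0 \<and> z = 0"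
    and deg: "\<And>y z. degenerate (quadratic_point G0 G1 G2 y z)"
  shows "\<exists>C0 C1 C2. quadratic_syzygy \<alpha> \<beta> C0 C1 C2"
proof -
  have "degenerate G0" using deg[of 1 0] by (simp add: quadratic_point_def)
  then obtain s0 t0 where st0: "(s0, t0) \<noteq> (0, 0)" and r0: "smult s0 (a G0) + smult t0 (b G0) = 0"
    unfolding degenerate_def by blast
  have "degenerate G2" using deg[of 0 1] by (simp add: quadratic_point_def)
  then obtain s2 t2 where st2: "(s2, t2) \<noteq> (0, 0)" and r2: "smult s2 (a G2) + smult t2 (b G2) = 0"
    unfolding degenerate_def by blast
  define a' where "a' x = smult s0 (a x) + smult t0 (b x)" for x
  define b' where "b' x = smult s2 (a x) + smult t2 (b x)" for x
  define \<Delta> where "\<Delta> = s0 * t2 - s2 * t0"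
  have lin: "a' (x + y) = a' x + a' y" "b' (x + y) = b' x + b' y"
    "a' (c *s x) = smult c (a' x)" "b' (c *s x) = smult c (b' x)" for x y c
    by (simp_all add: a'_def b'_def smult_add_right algebra_simps)
  have \<Delta>: "\<Delta> \<noteq> 0"
  proof
    assume "\<Delta> = 0"
    have "smult s0 (smult s2 (a G2) + smult t2 (b G2)) = 0"
      "smult t0 (smult s2 (a G2) + smult t2 (b G2)) = 0" using r2 by simp_all
    then have "smult s2 (a' G2) = 0" "smult t2 (a' G2) = 0"
      using \<open>\<Delta> = 0\<close> by (simp_all add: a'_def \<Delta>_def smult_add_right mult.commute)
    with st2 have "a' G2 = 0" by auto
    then obtain p q where "(p, q) \<noteq> (0, 0)" "p *s G0 + q *s G2 = 0"
      using kernel_at_most_line[OF st0 r0, of G2] unfolding a'_def by blast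
    with ind[of p 0 q] show False by simp
  qed
  have inj': "x = 0" if "a' x = 0" "b' x = 0" for x
  proof (rule injective)
    have "smult \<Delta> (a x) = smult t2 (a' x) - smult t0 (b' x)"
      "smult \<Delta> (b x) = smult s0 (b' x) - smult s2 (a' x)"
      by (rule poly_eqI, simp add: a'_def b'_def \<Delta>_def algebra_simps)+
    with that \<Delta> show "a x = 0" "b x = 0" by auto
  qed
  have a0: "a' G0 = 0" and b2: "b' G2 = 0" using r0 r2 by (simp_all add: a'_def b'_def)
  have b0: "b' G0 \<noteq> 0"
  proof
    assume "b' G0 = 0"
    with a0 inj' have "G0 = 0" by blast
    with ind[of 1 0 0] show False by simp
  qed
  have a2: "a' G2 \<noteq> 0"
  proof
    assume "a' G2 = 0"
    with b2 inj' have "G2 = 0" by blast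
    with ind[of 0 0 1] show False by simp
  qed
  have W: "wedge (a' G1 + smult z (a' G2)) (b' G0 + smult z (b' G1)) i j = 0" if "z \<noteq> 0" for z i j
  proof -
    obtain s t where st: "(s, t) \<noteq> (0, 0)"
      and r: "smult s (a (quadratic_point G0 G1 G2 1 z)) + smult t (b (quadratic_point G0 G1 G2 1 z)) = 0"
      using deg[of 1 z] unfolding degenerate_def by blast
    have w: "wedge (a (quadratic_point G0 G1 G2 1 z)) (b (quadratic_point G0 G1 G2 1 z)) i j = 0"
      by (rule wedge_zero_of_relation[OF r st])
    have "wedge (a' (quadratic_point G0 G1 G2 1 z)) (b' (quadratic_point G0 G1 G2 1 z)) i j =
        \<Delta> * wedge (a (quadratic_point G0 G1 G2 1 z)) (b (quadratic_point G0 G1 G2 1 z)) i j"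
      by (simp add: wedge_def a'_def b'_def \<Delta>_def algebra_simps)
    also have "\<dots> = 0" by (simp add: w)
    also have "a' (quadratic_point G0 G1 G2 1 z) = smult z (a' G1 + smult z (a' G2))"
      by (simp add: quadratic_point_def lin a0 smult_add_right power2_eq_square)
    also have "b' (quadratic_point G0 G1 G2 1 z) = b' G0 + smult z (b' G1)"
      by (simp add: quadratic_point_def lin b2)
    finally show ?thesis using that by (simp add: wedge_smult_left)
  qed
  have W': "wedge (a' G1) (b' G0) i j = 0 \<and>
      wedge (a' G1) (b' G1) i j + wedge (a' G2) (b' G0) i j = 0 \<and> wedge (a' G2) (b' G1) i j = 0" for i j
    by (rule quadratic_zero_on_units)
      (use W[of _ i j] in \<open>simp add: wedge_def algebra_simps power2_eq_square\<close>)
  have "\<exists>l. a' G1 = smult l (b' G0)"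
    by (rule proportional_of_wedge_zero[OF b0]) (use W' in \<open>simp add: wedge_def algebra_simps\<close>)
  then obtain l where l: "a' G1 = smult l (b' G0)" by blast
  have "\<exists>\<mu>. b' G1 = smult \<mu> (a' G2)"
    by (rule proportional_of_wedge_zero[OF a2]) (use W' in \<open>simp add: wedge_def algebra_simps\<close>)
  then obtain m where m: "b' G1 = smult m (a' G2)" by blast
  have "(l * m - 1) * wedge (b' G0) (a' G2) i j =
      wedge (a' G1) (b' G1) i j + wedge (a' G2) (b' G0) i j" for i j
    unfolding l m by (simp add: wedge_def algebra_simps)
  then have lm: "(l * m - 1) * wedge (b' G0) (a' G2) i j = 0" for i j using W' by metis
  have "l * m = 1"
  proof (rule ccontr)
    assume "l * m \<noteq> 1"
    with lm have "wedge (b' G0) (a' G2) i j = 0" for i j by simp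
    then obtain c where c: "a' G2 = smult c (b' G0)"
      using proportional_of_wedge_zero[OF b0] by blast
    with a2 have "c \<noteq> 0" by auto
    \<comment> \<open>Both \<open>a'\<close> and \<open>b'\<close> kill this combination when all four images are multiples of \<open>b'(G\<^sub>0)\<close>.\<close>
    have "(- m * c) *s G0 + 1 *s G1 + (- l / c) *s G2 = 0"
      by (rule inj')
        (unfold lin a0 l m b2 c, use \<open>c \<noteq> 0\<close> in \<open>auto intro!: poly_eqI\<close>)
    from ind[OF this] show False by simp
  qed
  then have l0: "l \<noteq> 0" by auto
  have mover: "smult y (a' (quadratic_point G0 G1 G2 y z)) = smult (l * z) (b' (quadratic_point G0 G1 G2 y z))" for y z
  proof -
    have "smult (l * z) (b' (quadratic_point G0 G1 G2 y z)) =
        smult y (a' (quadratic_point G0 G1 G2 y z)) + smult ((l * m - 1) * y * z\<^sup>2) (a' G2)"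
      unfolding quadratic_point_def lin a0 b2 unfolding l m
      by (rule poly_eqI) (simp add: algebra_simps power2_eq_square)
    with \<open>l * m = 1\<close> show ?thesis by simp
  qed
  \<comment> \<open>The solution of \<open>\<sigma> : \<tau> = (y s0 - l z s2) : (y t0 - l z t2)\<close> for \<open>y : z\<close>, free of denominators.\<close>
  define Y where "Y \<sigma> \<tau> = l * (t2 * \<sigma> - s2 * \<tau>)" for \<sigma> \<tau>
  define Z where "Z \<sigma> \<tau> = t0 * \<sigma> - s0 * \<tau>" for \<sigma> \<tau>
  define C0 where "C0 = quadratic_point G0 G1 G2 (Y 1 0) (Z 1 0)"
  define C1 where "C1 = (2 * Y 1 0 * Y 0 1) *s G0 + (Y 1 0 * Z 0 1 + Y 0 1 * Z 1 0) *s G1 + (2 * Z 1 0 * Z 0 1) *s G2"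
  define C2 where "C2 = quadratic_point G0 G1 G2 (Y 0 1) (Z 0 1)"
  have C: "quadratic_point C0 C1 C2 \<sigma> \<tau> = quadratic_point G0 G1 G2 (Y \<sigma> \<tau>) (Z \<sigma> \<tau>)" for \<sigma> \<tau>
    unfolding C0_def C1_def C2_def quadratic_point_def Y_def Z_def
    by (simp add: vec_eq_iff power2_eq_square algebra_simps)
  have "quadratic_syzygy \<alpha> \<beta> C0 C1 C2"
  proof (rule quadratic_syzygyI_pointwise)
    fix \<sigma> \<tau>
    define P where "P = quadratic_point G0 G1 G2 (Y \<sigma> \<tau>) (Z \<sigma> \<tau>)"
    have "smult (l * \<Delta>) (smult \<sigma> (a P) + smult \<tau> (b P)) =
        smult (Y \<sigma> \<tau>) (a' P) - smult (l * Z \<sigma> \<tau>) (b' P)"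
      by (rule poly_eqI) (simp add: Y_def Z_def a'_def b'_def \<Delta>_def algebra_simps)
    also have "\<dots> = 0" using mover by (simp add: P_def)
    finally show "smult \<sigma> (a (quadratic_point C0 C1 C2 \<sigma> \<tau>)) + smult \<tau> (b (quadratic_point C0 C1 C2 \<sigma> \<tau>)) = 0"
      using l0 \<Delta> unfolding C P_def by simp
  next
    show "\<not> (C0 = 0 \<and> C1 = 0 \<and> C2 = 0)"
    proof
      assume "C0 = 0 \<and> C1 = 0 \<and> C2 = 0"
      then have z: "quadratic_point G0 G1 G2 (Y \<sigma> \<tau>) (Z \<sigma> \<tau>) = 0" for \<sigma> \<tau>
        using C[of \<sigma> \<tau>] by (simp add: quadratic_point_def)
      have "Y s0 t0 = l * \<Delta>" "Z s0 t0 = 0"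
        by (simp_all add: Y_def Z_def \<Delta>_def algebra_simps)
      with z[of s0 t0] ind[of "(l * \<Delta>)\<^sup>2" 0 0] l0 \<Delta> show False by (simp add: quadratic_point_def)
    qed
  qed
  then show ?thesis by blast
qed

end

section \<open>Smooth conics\<close>

definition quad_form_vec :: "'b::field \<Rightarrow> 'b \<Rightarrow> 'b \<Rightarrow> 'b \<Rightarrow> 'b \<Rightarrow> 'b \<Rightarrow> 'b^3 \<Rightarrow> 'b" where
  "quad_form_vec a b c d e h x = quad_form a b c d e h (x$1) (x$2) (x$3)"

definition polar :: "'b::field \<Rightarrow> 'b \<Rightarrow> 'b \<Rightarrow> 'b \<Rightarrow> 'b \<Rightarrow> 'b \<Rightarrow> 'b^3 \<Rightarrow> 'b^3 \<Rightarrow> 'b" where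
  "polar a b c d e h x y = (2 * a * x$1 + d * x$2 + e * x$3) * y$1
     + (2 * b * x$2 + d * x$1 + h * x$3) * y$2
     + (2 * c * x$3 + e * x$1 + h * x$2) * y$3"

lemma quad_form_vec_add:
  "quad_form_vec a b c d e h (x + y) = quad_form_vec a b c d e h x + quad_form_vec a b c d e h y + polar a b c d e h x y"
  by (simp add: quad_form_vec_def polar_def quad_form_def algebra_simps power2_eq_square)

definition smooth_form :: "'b::field \<Rightarrow> 'b \<Rightarrow> 'b \<Rightarrow> 'b \<Rightarrow> 'b \<Rightarrow> 'b \<Rightarrow> bool" where
  "smooth_form a b c d e h \<longleftrightarrow>
     (\<forall>x y z. (x, y, z) \<noteq> (0, 0, 0) \<longrightarrow> \<not> singular_zero a b c d e h x y z)"

lemma singular_zero_iff_polar: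
  "singular_zero a b c d e h (x$1) (x$2) (x$3) \<longleftrightarrow>
     quad_form_vec a b c d e h x = 0 \<and> (\<forall>y. polar a b c d e h x y = 0)"
proof -
  have "2 * a * x$1 + d * x$2 + e * x$3 = polar a b c d e h x (axis 1 1)"
    "2 * b * x$2 + d * x$1 + h * x$3 = polar a b c d e h x (axis 2 1)"
    "2 * c * x$3 + e * x$1 + h * x$2 = polar a b c d e h x (axis 3 1)"
    by (simp_all add: polar_def axis_def)
  note e = this
  show ?thesis
  proof
    assume "singular_zero a b c d e h (x$1) (x$2) (x$3)"
    then show "quad_form_vec a b c d e h x = 0 \<and> (\<forall>y. polar a b c d e h x y = 0)"
      unfolding singular_zero_def quad_form_vec_def polar_def by simp
  next
    assume "quad_form_vec a b c d e h x = 0 \<and> (\<forall>y. polar a b c d e h x y = 0)"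
    then show "singular_zero a b c d e h (x$1) (x$2) (x$3)"
      unfolding singular_zero_def e by (simp add: quad_form_vec_def)
  qed
qed

lemma exists_isotropic_vector:
  fixes a b c d e h :: "'b::alg_closed_field"
  shows "\<exists>x::'b^3. x \<noteq> 0 \<and> quad_form_vec a b c d e h x = 0"
proof (cases "a = 0")
  case True
  then have "quad_form_vec a b c d e h (vector [1, 0, 0]) = 0"
    by (simp add: quad_form_vec_def quad_form_def vector_3)
  moreover have "vector [1, 0, 0] \<noteq> (0 :: 'b^3)"
    by (simp add: vec_eq_iff forall_3 vector_3)
  ultimately show ?thesis by blast
next
  case False
  then have "degree [:b, d, a:] > 0" by simp
  then obtain r where "poly [:b, d, a:] r = 0"
    using alg_closed_imp_poly_has_root by blast
  then have "quad_form_vec a b c d e h (vector [r, 1, 0]) = 0"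
    by (simp add: quad_form_vec_def quad_form_def vector_3 algebra_simps power2_eq_square)
  moreover have "vector [r, 1, 0] \<noteq> (0 :: 'b^3)"
    by (simp add: vec_eq_iff forall_3 vector_3)
  ultimately show ?thesis by blast
qed

text \<open>Take an isotropic \<open>G\<^sub>0\<close>. It is not singular, so there is a second isotropic \<open>G\<^sub>2\<close> with
  \<open>B(G\<^sub>0, G\<^sub>2) = 1\<close> for the polar form \<open>B\<close>. The vector \<open>G\<^sub>1\<close> orthogonal to both is anisotropic,
  as it would otherwise be a singular point, and can be scaled to cancel the mixed term. The point
  \<open>G\<^sub>1\<close> is the intersection of the tangents at \<open>G\<^sub>0\<close> and \<open>G\<^sub>2\<close>. No division by two occurs, so the
  argument is valid in every characteristic.\<close>

lemma smooth_form_parametrization: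
  fixes a b c d e h :: "'b::alg_closed_field"
  assumes smooth: "smooth_form a b c d e h"
  shows "\<exists>G0 G1 G2 :: 'b^3.
    (\<forall>x y z. x *s G0 + y *s G1 + z *s G2 = 0 \<longrightarrow> x = 0 \<and> y = 0 \<and> z = 0) \<and>
    (\<forall>y z. quad_form_vec a b c d e h (quadratic_point G0 G1 G2 y z) = 0)"
proof -
  define Q where "Q = quad_form_vec a b c d e h"
  define B where "B = polar a b c d e h"
  have Q_add: "Q (x + y) = Q x + Q y + B x y" for x y
    by (simp add: Q_def B_def quad_form_vec_add)
  have Q_scale: "Q (k *s x) = k\<^sup>2 * Q x" for x k
    by (simp add: Q_def quad_form_vec_def quad_form_def algebra_simps power2_eq_square)
  have B_lin: "B (x + y) w = B x w + B y w" "B w (x + y) = B w x + B w y"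
    "B (k *s x) w = k * B x w" "B w (k *s x) = k * B w x" "B x x = 2 * Q x" for x y w k
    by (simp_all add: Q_def B_def quad_form_vec_def polar_def quad_form_def algebra_simps power2_eq_square)
  have B_sym: "B x y = B y x" for x y
    by (simp add: B_def polar_def algebra_simps)
  have regular: "\<exists>y. B x y \<noteq> 0" if "x \<noteq> 0" "Q x = 0" for x
  proof -
    have "(x$1, x$2, x$3) \<noteq> (0, 0, 0)" using \<open>x \<noteq> 0\<close> by (auto simp: vec_eq_iff forall_3)
    then have "\<not> singular_zero a b c d e h (x$1) (x$2) (x$3)"
      using smooth unfolding smooth_form_def by blast
    then show ?thesis using that unfolding singular_zero_iff_polar Q_def B_def by blast
  qed
  obtain G0 where G0: "G0 \<noteq> 0" "Q G0 = 0"
    using exists_isotropic_vector[of a b c d e h] unfolding Q_def by blast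
  obtain v where v: "B G0 v \<noteq> 0" using regular[OF G0] by blast
  define w where "w = (1 / B G0 v) *s v"
  have w: "B G0 w = 1" using v by (simp add: w_def B_lin)
  define G2 where "G2 = w + (- Q w) *s G0"
  have w': "B w G0 = 1" using w B_sym[of w G0] by simp
  have "Q G2 = 0" unfolding G2_def Q_add Q_scale B_lin G0 w' by simp
  moreover have "B G0 G2 = 1" unfolding G2_def B_lin G0 w by simp
  ultimately have G2: "Q G2 = 0" "B G0 G2 = 1" "B G2 G0 = 1" using B_sym[of G2 G0] by simp_all
  have "x = 0 \<and> y = 0" if "x *s G0 + y *s G2 = 0" for x y
  proof -
    have z: "B 0 u = 0" for u by (simp add: B_def polar_def)
    have "B (x *s G0 + y *s G2) G2 = x" "B (x *s G0 + y *s G2) G0 = y"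
      by (simp_all only: B_lin G0 G2) simp_all
    then show ?thesis unfolding that z by simp
  qed
  then obtain E where E: "\<And>v. \<exists>x y z. v = x *s G0 + y *s G2 + z *s E"
    and E_ind: "\<And>x y z. x *s G0 + y *s G2 + z *s E = 0 \<Longrightarrow> x = 0 \<and> y = 0 \<and> z = 0"
    using independent_pair_extends[of G0 G2] by blast
  define H where "H = E + (- B E G2) *s G0 + (- B E G0) *s G2"
  have H: "B H G0 = 0" "B H G2 = 0"
    unfolding H_def B_lin G0 G2 by simp_all
  have "Q H \<noteq> 0"
  proof
    assume QH: "Q H = 0"
    have E': "E = H + B E G2 *s G0 + B E G0 *s G2" by (simp add: H_def vec_eq_iff)
    have "H \<noteq> 0"
    proof
      assume "H = 0"
      then have "(- B E G2) *s G0 + (- B E G0) *s G2 + 1 *s E = 0"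
        by (simp add: H_def algebra_simps)
      from E_ind[OF this] show False by simp
    qed
    moreover have "B H u = 0" for u
    proof -
      obtain x y z where "u = x *s G0 + y *s G2 + z *s E" using E by blast
      moreover have "B H E = 0"
        by (subst E') (simp add: B_lin H QH)
      ultimately show ?thesis by (simp add: B_lin H)
    qed
    ultimately show False using regular[of H] QH by blast
  qed
  have "\<exists>k. k ^ 2 = - 1 / Q H" by (rule nth_root_exists) simp
  then obtain k where k: "k\<^sup>2 = - 1 / Q H" by blast
  define G1 where "G1 = k *s H"
  have G1: "Q G1 = - 1" "B G1 G0 = 0" "B G1 G2 = 0" "B G0 G1 = 0"
    using k \<open>Q H \<noteq> 0\<close> B_sym[of G0 G1] by (simp_all add: G1_def Q_scale B_lin H)
  have "G1 \<noteq> 0" using G1(1) by (auto simp: Q_def quad_form_vec_def quad_form_def)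
  have ind: "x = 0 \<and> y = 0 \<and> z = 0" if h: "x *s G0 + y *s G1 + z *s G2 = 0" for x y z
  proof -
    have Z: "B 0 u = 0" for u by (simp add: B_def polar_def)
    have "B (x *s G0 + y *s G1 + z *s G2) G2 = x" "B (x *s G0 + y *s G1 + z *s G2) G0 = z"
      by (simp_all only: B_lin G0 G1 G2) simp_all
    then have "x = 0" "z = 0" unfolding h Z by simp_all
    with h \<open>G1 \<noteq> 0\<close> show ?thesis by simp
  qed
  moreover have "Q (quadratic_point G0 G1 G2 y z) = 0" for y z
    unfolding quadratic_point_def Q_add Q_scale B_lin G0 G1 G2 by (simp add: power2_eq_square)
  ultimately show ?thesis unfolding Q_def by blast
qed

text \<open>In characteristic two the polar form of \<open>\<eta>\<^sup>2 - \<xi> \<zeta>\<close> is degenerate, but pairing a singular point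
  with \<open>C\<^sub>0\<close> and \<open>C\<^sub>2\<close> still gives \<open>\<xi> = \<zeta> = 0\<close>, and then the form itself gives \<open>\<eta> = 0\<close>.\<close>

lemma smooth_form_of_dual_coordinates:
  fixes C0 C1 C2 :: "'b::field^3" and \<xi> \<eta> \<zeta> :: "'b^3 \<Rightarrow> 'b"
  assumes dual: "\<And>w. w = \<xi> w *s C0 + \<eta> w *s C1 + \<zeta> w *s C2"
    and ind: "\<And>x y z. x *s C0 + y *s C1 + z *s C2 = 0 \<Longrightarrow> x = 0 \<and> y = 0 \<and> z = 0"
    and Q: "\<And>w. quad_form_vec a b c d e h w = (\<eta> w)\<^sup>2 - \<xi> w * \<zeta> w"
  shows "smooth_form a b c d e h"
proof -
  have coords: "\<xi> w = x \<and> \<eta> w = y \<and> \<zeta> w = z" if "w = x *s C0 + y *s C1 + z *s C2" for w x y z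
  proof -
    have "(\<xi> w - x) *s C0 + (\<eta> w - y) *s C1 + (\<zeta> w - z) *s C2 =
        (\<xi> w *s C0 + \<eta> w *s C1 + \<zeta> w *s C2) - (x *s C0 + y *s C1 + z *s C2)"
      by (simp add: vec_eq_iff algebra_simps)
    also have "\<dots> = 0" using dual[of w] that by simp
    finally show ?thesis using ind by force
  qed
  have polar: "polar a b c d e h w u =
      quad_form_vec a b c d e h (w + u) - quad_form_vec a b c d e h w - quad_form_vec a b c d e h u" for w u
    by (simp add: quad_form_vec_add)
  have shift: "w + C0 = (\<xi> w + 1) *s C0 + \<eta> w *s C1 + \<zeta> w *s C2"
    "w + C2 = \<xi> w *s C0 + \<eta> w *s C1 + (\<zeta> w + 1) *s C2" for w
    by (subst dual[of w], simp add: vec_eq_iff algebra_simps)+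
  have w0: "w = 0" if q: "quad_form_vec a b c d e h w = 0" and B: "\<And>u. polar a b c d e h w u = 0" for w
  proof -
    have "\<xi> w = 0"
      using B[of C2] coords[OF shift(2)[of w]] coords[of C2 0 0 1]
      by (simp add: polar Q algebra_simps)
    moreover have "\<zeta> w = 0"
      using B[of C0] coords[OF shift(1)[of w]] coords[of C0 1 0 0]
      by (simp add: polar Q algebra_simps)
    ultimately have "\<eta> w = 0" using q by (simp add: Q)
    with \<open>\<xi> w = 0\<close> \<open>\<zeta> w = 0\<close> dual[of w] show ?thesis by simp
  qed
  have "\<not> singular_zero a b c d e h x y z" if "(x, y, z) \<noteq> (0, 0, 0)" for x y z
  proof
    assume sing: "singular_zero a b c d e h x y z"
    have "vector [x, y, z] = (0 :: 'b^3)"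
      using sing singular_zero_iff_polar[of a b c d e h "vector [x, y, z]"]
      by (intro w0) (simp_all add: vector_3)
    with that show False by (auto simp: vec_eq_iff forall_3 vector_3)
  qed
  then show ?thesis unfolding smooth_form_def by blast
qed

section \<open>Descent from the algebraic closure\<close>

definition vec_map :: "('x \<Rightarrow> 'y) \<Rightarrow> 'x^3 \<Rightarrow> 'y^3" where
  "vec_map g x = (\<chi> i. g (x$i))"

lemma vec_map_nth [simp]: "vec_map g x $ i = g (x$i)"
  by (simp add: vec_map_def)

definition coeffs_to_ac :: "(3 \<Rightarrow> 'a::field poly) \<Rightarrow> 3 \<Rightarrow> 'a alg_closure poly" where
  "coeffs_to_ac \<alpha> i = map_poly to_ac (\<alpha> i)"

text \<open>A nonzero element of the closure, as a vector space over the ground field, extends to a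
  basis. Applying such a functional entrywise turns a solution of a linear system over the ground
  field into a solution with entries in it, and the chosen nonzero entry stays nonzero.\<close>

lemma exists_functional_over_base:
  fixes x :: "'a::field alg_closure"
  assumes "x \<noteq> 0"
  shows "\<exists>\<phi> :: 'a alg_closure \<Rightarrow> 'a. (\<forall>y z. \<phi> (y + z) = \<phi> y + \<phi> z) \<and>
    (\<forall>c y. \<phi> (to_ac c * y) = c * \<phi> y) \<and> \<phi> x \<noteq> 0"
proof -
  interpret V: vector_space_pair "\<lambda>c y. to_ac c * (y :: 'a alg_closure)" "(*) :: 'a \<Rightarrow> 'a \<Rightarrow> 'a"
    by unfold_locales (simp_all add: algebra_simps)
  have "V.vs1.independent {x}" using assms by simp
  from V.linear_independent_extend[OF this, of "\<lambda>_. 1"]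
  obtain \<phi> where "Vector_Spaces.linear (\<lambda>c y. to_ac c * y) (*) \<phi>" "\<phi> x = 1" by auto
  then show ?thesis
    by (intro exI[of _ \<phi>]) (simp add: V.linear_add V.linear_scale)
qed

lemma coeff_lincomb: "coeff (lincomb \<alpha> x) k = (\<Sum>i\<in>UNIV. x$i * coeff (\<alpha> i) k)"
  by (simp add: lincomb_def coeff_sum)

lemma coeff_lincomb_vec_map_functional:
  fixes \<phi> :: "'a::field alg_closure \<Rightarrow> 'a"
  assumes "\<And>y z. \<phi> (y + z) = \<phi> y + \<phi> z" and "\<And>c y. \<phi> (to_ac c * y) = c * \<phi> y"
  shows "coeff (lincomb \<alpha> (vec_map \<phi> x)) k = \<phi> (coeff (lincomb (coeffs_to_ac \<alpha>) x) k)"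
  by (simp add: coeff_lincomb sum_3 coeffs_to_ac_def coeff_map_poly assms mult.commute[of _ "to_ac _"])

lemma coeff_lincomb_vec_map_to_ac:
  "coeff (lincomb (coeffs_to_ac \<alpha>) (vec_map to_ac x)) k = to_ac (coeff (lincomb \<alpha> x) k)"
  by (simp add: coeff_lincomb sum_3 coeffs_to_ac_def coeff_map_poly)

lemma vec3_neq_0: "x \<noteq> 0 \<Longrightarrow> \<exists>i. x$i \<noteq> 0" for x :: "'x::zero^3"
  by (auto simp: vec_eq_iff)

lemma quadratic_syzygy_descends:
  assumes syz: "quadratic_syzygy (coeffs_to_ac \<alpha>) (coeffs_to_ac \<beta>) C0 C1 C2"
  shows "\<exists>D0 D1 D2. quadratic_syzygy \<alpha> \<beta> D0 D1 D2"
proof -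
  obtain C i where C: "C \<in> {C0, C1, C2}" "C$i \<noteq> 0"
    using syz vec3_neq_0 unfolding quadratic_syzygy_def by blast
  obtain \<phi> where \<phi>: "\<And>y z. \<phi> (y + z) = \<phi> y + \<phi> z" "\<And>c y. \<phi> (to_ac c * y) = c * \<phi> y" "\<phi> (C$i) \<noteq> 0"
    using exists_functional_over_base[OF C(2)] by blast
  note push = coeff_lincomb_vec_map_functional[OF \<phi>(1,2)]
  have \<phi>0: "\<phi> 0 = 0" using \<phi>(2)[of 0 0] by simp
  have c: "coeff (lincomb (coeffs_to_ac \<alpha>) C0) k = 0"
    "coeff (lincomb (coeffs_to_ac \<beta>) C0) k + coeff (lincomb (coeffs_to_ac \<alpha>) C1) k = 0"
    "coeff (lincomb (coeffs_to_ac \<beta>) C1) k + coeff (lincomb (coeffs_to_ac \<alpha>) C2) k = 0"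
    "coeff (lincomb (coeffs_to_ac \<beta>) C2) k = 0" for k
    using syz unfolding quadratic_syzygy_def coeff_add[symmetric] by simp_all
  have "\<not> (vec_map \<phi> C0 = 0 \<and> vec_map \<phi> C1 = 0 \<and> vec_map \<phi> C2 = 0)"
    using C(1) \<phi>(3) by (metis insertE singletonD vec_map_nth zero_index)
  then have "quadratic_syzygy \<alpha> \<beta> (vec_map \<phi> C0) (vec_map \<phi> C1) (vec_map \<phi> C2)"
    unfolding quadratic_syzygy_def
    by (auto intro!: poly_eqI simp: push c \<phi>0 simp flip: \<phi>(1))
  then show ?thesis by blast
qed

lemma quadratic_syzygy_extends:
  assumes syz: "quadratic_syzygy \<alpha> \<beta> C0 C1 C2"
  shows "quadratic_syzygy (coeffs_to_ac \<alpha>) (coeffs_to_ac \<beta>) (vec_map to_ac C0) (vec_map to_ac C1) (vec_map to_ac C2)"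
proof -
  have c: "coeff (lincomb \<alpha> C0) k = 0"
    "coeff (lincomb \<beta> C0) k + coeff (lincomb \<alpha> C1) k = 0"
    "coeff (lincomb \<beta> C1) k + coeff (lincomb \<alpha> C2) k = 0"
    "coeff (lincomb \<beta> C2) k = 0" for k
    using syz unfolding quadratic_syzygy_def coeff_add[symmetric] by simp_all
  have "vec_map to_ac C = 0 \<Longrightarrow> C = 0" for C :: "'a^3"
    by (simp add: vec_eq_iff)
  then show ?thesis
    using syz unfolding quadratic_syzygy_def
    by (auto intro!: poly_eqI simp: coeff_lincomb_vec_map_to_ac c simp flip: to_ac_add)
qed

lemma common_kernel_descends:
  assumes inj: "\<And>x. lincomb \<alpha> x = 0 \<Longrightarrow> lincomb \<beta> x = 0 \<Longrightarrow> x = 0"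
    and "lincomb (coeffs_to_ac \<alpha>) x = 0" and "lincomb (coeffs_to_ac \<beta>) x = 0"
  shows "x = 0"
proof (rule ccontr)
  assume "x \<noteq> 0"
  then obtain i where i: "x$i \<noteq> 0" using vec3_neq_0 by blast
  obtain \<phi> where \<phi>: "\<And>y z. \<phi> (y + z) = \<phi> y + \<phi> z" "\<And>c y. \<phi> (to_ac c * y) = c * \<phi> y" "\<phi> (x$i) \<noteq> 0"
    using exists_functional_over_base[OF i] by blast
  have \<phi>0: "\<phi> 0 = 0" using \<phi>(2)[of 0 0] by simp
  have "vec_map \<phi> x = 0"
    by (rule inj; rule poly_eqI) (simp_all add: coeff_lincomb_vec_map_functional[OF \<phi>(1,2)] assms \<phi>0)
  with \<phi>(3) show False by (metis vec_map_nth zero_index)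
qed

section \<open>Bihomogeneous polynomials and their slices\<close>

abbreviation lookup :: "('k \<Rightarrow>\<^sub>0 'v::zero) \<Rightarrow> 'k \<Rightarrow> 'v" where
  "lookup \<equiv> Poly_Mapping.lookup"

definition mon :: "nat \<Rightarrow> nat \<Rightarrow> nat \<Rightarrow> nat \<Rightarrow> (var \<Rightarrow>\<^sub>0 nat)" where
  "mon i j k l = Poly_Mapping.single Var_s i + Poly_Mapping.single Var_t j
     + Poly_Mapping.single Var_u k + Poly_Mapping.single Var_v l"

lemma lookup_mon [simp]:
  "lookup (mon i j k l) Var_s = i" "lookup (mon i j k l) Var_t = j"
  "lookup (mon i j k l) Var_u = k" "lookup (mon i j k l) Var_v = l"
  by (simp_all add: mon_def lookup_add lookup_single when_def)

lemma mon_eq_iff [simp]: "mon i j k l = mon i' j' k' l' \<longleftrightarrow> i = i' \<and> j = j' \<and> k = k' \<and> l = l'"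
  by (metis lookup_mon)

lemma mon_cases: obtains i j k l where "m = mon i j k l"
proof
  show "m = mon (lookup m Var_s) (lookup m Var_t) (lookup m Var_u) (lookup m Var_v)"
  proof (rule poly_mapping_eqI)
    fix x show "lookup m x = lookup (mon (lookup m Var_s) (lookup m Var_t) (lookup m Var_u) (lookup m Var_v)) x"
      by (cases x) simp_all
  qed
qed

lemma mon_add: "mon i j k l + mon i' j' k' l' = mon (i + i') (j + j') (k + k') (l + l')"
  by (simp add: mon_def single_add algebra_simps)

lemma lookup_single_mult:
  fixes p :: "'a::field bipoly"
  shows "lookup (Poly_Mapping.single (mon i j k l) c * p) (mon i' j' k' l') =
    (if i \<le> i' \<and> j \<le> j' \<and> k \<le> k' \<and> l \<le> l'
     then c * lookup p (mon (i' - i) (j' - j) (k' - k) (l' - l)) else 0)"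
proof -
  let ?m = "mon i j k l" and ?m' = "mon i' j' k' l'"
  have "lookup (Poly_Mapping.single ?m c * p) ?m' = c * (\<Sum>q. lookup p q when ?m' = ?m + q)"
    by (simp add: lookup_mult lookup_single when_mult)
  also have "(\<Sum>q. lookup p q when ?m' = ?m + q) =
     (if i \<le> i' \<and> j \<le> j' \<and> k \<le> k' \<and> l \<le> l' then lookup p (mon (i' - i) (j' - j) (k' - k) (l' - l)) else 0)"
  proof (cases "i \<le> i' \<and> j \<le> j' \<and> k \<le> k' \<and> l \<le> l'")
    case True
    then have "?m' = ?m + q \<longleftrightarrow> q = mon (i' - i) (j' - j) (k' - k) (l' - l)" for q
      by (cases q rule: mon_cases) (auto simp: mon_add)
    with True show ?thesis by simp
  next
    case False
    then have "?m' \<noteq> ?m + q" for q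
      by (cases q rule: mon_cases) (auto simp: mon_add)
    with False show ?thesis by (simp only: when_def) simp
  qed
  finally show ?thesis by simp
qed

lemma lookup_smul [simp]: "lookup (smul c p) m = c * lookup p m"
  unfolding smul_def mult_map_scale_conv_mult[symmetric] by (simp add: map.rep_eq when_def)

lemma lookup_base_change [simp]: "lookup (base_change p) m = to_ac (lookup p m)"
  by (simp add: base_change_def map.rep_eq when_def)

lemma bihom_0 [simp]: "0 \<in> bihom a b"
  by (simp add: bihom_def)

lemma bihom_iff: "p \<in> bihom a b \<longleftrightarrow> (\<forall>i j k l. lookup p (mon i j k l) \<noteq> 0 \<longrightarrow> i + j = a \<and> k + l = b)"
proof
  assume "p \<in> bihom a b"
  then show "\<forall>i j k l. lookup p (mon i j k l) \<noteq> 0 \<longrightarrow> i + j = a \<and> k + l = b"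
    unfolding bihom_def in_keys_iff[symmetric] by (auto dest!: bspec)
next
  assume *: "\<forall>i j k l. lookup p (mon i j k l) \<noteq> 0 \<longrightarrow> i + j = a \<and> k + l = b"
  show "p \<in> bihom a b"
    unfolding bihom_def
  proof safe
    fix m assume "m \<in> Poly_Mapping.keys p"
    then show "lookup m Var_s + lookup m Var_t = a" "lookup m Var_u + lookup m Var_v = b"
      using * by (cases m rule: mon_cases, auto simp: in_keys_iff)+
  qed
qed

lemma bihom_add: "p \<in> bihom a b \<Longrightarrow> q \<in> bihom a b \<Longrightarrow> p + q \<in> bihom a b"
  unfolding bihom_iff lookup_add by (metis add.right_neutral)

lemma bihom_sum: "(\<And>x. x \<in> S \<Longrightarrow> f x \<in> bihom a b) \<Longrightarrow> sum f S \<in> bihom a b"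
  by (induction S rule: infinite_finite_induct) (auto intro: bihom_add)

lemma bihom_smul: "p \<in> bihom a b \<Longrightarrow> smul c p \<in> bihom a b"
  unfolding bihom_iff by (simp, blast)

lemma bihom_base_change: "p \<in> bihom a b \<Longrightarrow> base_change p \<in> bihom a b"
  unfolding bihom_iff by simp

lemma bihom_mult: "p \<in> bihom a b \<Longrightarrow> q \<in> bihom c d \<Longrightarrow> p * q \<in> bihom (a + c) (b + d)"
  using keys_mult[of p q] unfolding bihom_def by (fastforce simp: lookup_add)

lemma single_mon_in_bihom: "Poly_Mapping.single (mon i j k l) c \<in> bihom (i + j) (k + l)"
  unfolding bihom_iff by (auto simp: lookup_single when_def split: if_splits)

text \<open>The form that multiplies \<open>s\<^sup>i t\<^sup>j\<close>, written as a univariate polynomial by setting \<open>v = 1\<close>;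
  knowing \<open>n\<close>, the power of \<open>v\<close> is recovered from that of \<open>u\<close>.\<close>

definition bislice :: "nat \<Rightarrow> nat \<Rightarrow> nat \<Rightarrow> 'a::field bipoly \<Rightarrow> 'a poly" where
  "bislice i j n p = (\<Sum>k\<le>n. monom (lookup p (mon i j k (n - k))) k)"

lemma coeff_bislice: "coeff (bislice i j n p) k = (if k \<le> n then lookup p (mon i j k (n - k)) else 0)"
  by (simp add: bislice_def coeff_sum if_distrib cong: if_cong)

lemma bislice_0 [simp]: "bislice i j n 0 = 0"
  and bislice_add [simp]: "bislice i j n (p + q) = bislice i j n p + bislice i j n q"
  and bislice_smul [simp]: "bislice i j n (smul c p) = smult c (bislice i j n p)"
  by (rule poly_eqI, simp add: coeff_bislice lookup_add)+

lemma bislice_base_change: "bislice i j n (base_change p) = map_poly to_ac (bislice i j n p)"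
  by (rule poly_eqI) (simp add: coeff_bislice coeff_map_poly)

lemma bihom_zeroI:
  assumes "p \<in> bihom r n" and "\<And>i j. i + j = r \<Longrightarrow> bislice i j n p = 0"
  shows "p = 0"
proof (rule poly_mapping_eqI)
  fix m
  obtain i j k l where m: "m = mon i j k l" by (rule mon_cases)
  show "lookup p m = lookup 0 m"
  proof (rule ccontr)
    assume "lookup p m \<noteq> lookup 0 m"
    then have "lookup p (mon i j k l) \<noteq> 0" by (simp add: m)
    moreover from this have e: "i + j = r" "k + l = n" using assms(1) unfolding bihom_iff by blast+
    moreover have "coeff (bislice i j n p) k = lookup p (mon i j k l)"
      using e(2) by (auto simp: coeff_bislice)
    ultimately show False using assms(2)[of i j] by simp
  qed
qed

text \<open>The homogenization that inverts the slice for forms of bidegree \<open>(0,n)\<close>.\<close>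

definition of_slice :: "nat \<Rightarrow> 'a::field poly \<Rightarrow> 'a bipoly" where
  "of_slice n g = (\<Sum>k\<le>n. Poly_Mapping.single (mon 0 0 k (n - k)) (coeff g k))"

lemma of_slice_bihom: "of_slice n g \<in> bihom 0 n"
  unfolding of_slice_def
proof (rule bihom_sum)
  fix k assume "k \<in> {..n}"
  then show "Poly_Mapping.single (mon 0 0 k (n - k)) (coeff g k) \<in> bihom 0 n"
    using single_mon_in_bihom[of 0 0 k "n - k"] by simp
qed

lemma bislice_of_slice:
  assumes "\<And>k. k > n \<Longrightarrow> coeff g k = 0"
  shows "bislice 0 0 n (of_slice n g) = g"
proof (rule poly_eqI)
  fix k
  have "lookup (of_slice n g) (mon 0 0 k (n - k)) = coeff g k" if "k \<le> n"
  proof -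
    have "lookup (of_slice n g) (mon 0 0 k (n - k)) = (\<Sum>k'\<le>n. if k' = k then coeff g k' else 0)"
      unfolding of_slice_def lookup_sum by (rule sum.cong) (auto simp: lookup_single when_def)
    then show ?thesis using that by simp
  qed
  then show "coeff (bislice 0 0 n (of_slice n g)) k = coeff g k"
    using assms[of k] by (auto simp: coeff_bislice)
qed

definition linear_st :: "'a::field \<Rightarrow> 'a \<Rightarrow> 'a bipoly" where
  "linear_st p q = Poly_Mapping.single (mon 1 0 0 0) p + Poly_Mapping.single (mon 0 1 0 0) q"

definition quadratic_st :: "'a::field \<Rightarrow> 'a \<Rightarrow> 'a \<Rightarrow> 'a bipoly" where
  "quadratic_st p q r = Poly_Mapping.single (mon 2 0 0 0) p + Poly_Mapping.single (mon 1 1 0 0) q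
    + Poly_Mapping.single (mon 0 2 0 0) r"

lemma linear_st_bihom: "linear_st p q \<in> bihom 1 0"
  unfolding bihom_iff linear_st_def by (auto simp: lookup_add lookup_single when_def split: if_splits)

lemma quadratic_st_bihom: "quadratic_st p q r \<in> bihom 2 0"
  unfolding bihom_iff quadratic_st_def by (auto simp: lookup_add lookup_single when_def split: if_splits)

lemma linear_st_eq_0_iff: "linear_st p q = 0 \<longleftrightarrow> p = 0 \<and> q = 0"
proof
  assume "linear_st p q = 0"
  then have "lookup (linear_st p q) (mon 1 0 0 0) = 0 \<and> lookup (linear_st p q) (mon 0 1 0 0) = 0"
    by simp
  then show "p = 0 \<and> q = 0" by (simp add: linear_st_def lookup_add lookup_single)
qed (simp add: linear_st_def)

lemma quadratic_st_eq_0_iff: "quadratic_st p q r = 0 \<longleftrightarrow> p = 0 \<and> q = 0 \<and> r = 0"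
proof
  assume "quadratic_st p q r = 0"
  then have "lookup (quadratic_st p q r) (mon 2 0 0 0) = 0 \<and> lookup (quadratic_st p q r) (mon 1 1 0 0) = 0
      \<and> lookup (quadratic_st p q r) (mon 0 2 0 0) = 0"
    by simp
  then show "p = 0 \<and> q = 0 \<and> r = 0" by (simp add: quadratic_st_def lookup_add lookup_single)
qed (simp add: quadratic_st_def)

lemma bihom_1_0_cases:
  assumes "l \<in> bihom 1 0"
  obtains p q where "l = linear_st p q"
proof
  show "l = linear_st (lookup l (mon 1 0 0 0)) (lookup l (mon 0 1 0 0))"
  proof (rule poly_mapping_eqI)
    fix m
    obtain i j k q where m: "m = mon i j k q" by (rule mon_cases)
    have "lookup l (mon i j k q) = 0" if "\<not> (i + j = 1 \<and> k = 0 \<and> q = 0)"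
      using assms that unfolding bihom_iff by auto
    then show "lookup l m = lookup (linear_st (lookup l (mon 1 0 0 0)) (lookup l (mon 0 1 0 0))) m"
      unfolding m linear_st_def lookup_add lookup_single when_def by (auto simp: add_is_1)
  qed
qed

lemma bihom_2_0_cases:
  assumes "c \<in> bihom 2 0"
  obtains p q r where "c = quadratic_st p q r"
proof
  show "c = quadratic_st (lookup c (mon 2 0 0 0)) (lookup c (mon 1 1 0 0)) (lookup c (mon 0 2 0 0))"
  proof (rule poly_mapping_eqI)
    fix m
    obtain i j k q where m: "m = mon i j k q" by (rule mon_cases)
    have z: "lookup c (mon i j k q) = 0" if "\<not> (i + j = 2 \<and> k = 0 \<and> q = 0)"
      using assms that unfolding bihom_iff by auto
    have "i + j = 2 \<Longrightarrow> i = 0 \<and> j = 2 \<or> i = 1 \<and> j = 1 \<or> i = 2 \<and> j = 0" by arith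
    with z show "lookup c m = lookup (quadratic_st (lookup c (mon 2 0 0 0)) (lookup c (mon 1 1 0 0))
        (lookup c (mon 0 2 0 0))) m"
      unfolding m quadratic_st_def lookup_add lookup_single when_def by auto
  qed
qed

lemma bislice_linear_mult:
  "bislice 1 0 n (linear_st p q * g) = smult p (bislice 0 0 n g)"
  "bislice 0 1 n (linear_st p q * g) = smult q (bislice 0 0 n g)"
  unfolding linear_st_def
  by (rule poly_eqI, simp add: coeff_bislice ring_distribs lookup_add lookup_single_mult)+

lemma bislice_quadratic_mult:
  "bislice 3 0 n (quadratic_st p q r * f) = smult p (bislice 1 0 n f)"
  "bislice 2 1 n (quadratic_st p q r * f) = smult p (bislice 0 1 n f) + smult q (bislice 1 0 n f)"
  "bislice 1 2 n (quadratic_st p q r * f) = smult q (bislice 0 1 n f) + smult r (bislice 1 0 n f)"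
  "bislice 0 3 n (quadratic_st p q r * f) = smult r (bislice 0 1 n f)"
  unfolding quadratic_st_def
  by (rule poly_eqI, simp add: coeff_bislice ring_distribs lookup_add lookup_single_mult)+

lemma bipoly_induct [case_names zero single add]:
  fixes p :: "'a::field bipoly"
  assumes "P 0" and "\<And>m c. P (Poly_Mapping.single m c)" and "\<And>p q. P p \<Longrightarrow> P q \<Longrightarrow> P (p + q)"
  shows "P p"
proof (induction p rule: Poly_Mapping.update_induct)
  case const
  show ?case by fact
next
  case (update f a b)
  have "Poly_Mapping.update a b f = f + Poly_Mapping.single a b"
    using update(1) by (intro poly_mapping_eqI)
      (auto simp: Poly_Mapping.lookup_update lookup_add lookup_single when_def in_keys_iff)
  with update assms show ?case by simp
qed

definition eval_mon :: "'b::field \<Rightarrow> 'b \<Rightarrow> 'b \<Rightarrow> 'b \<Rightarrow> (var \<Rightarrow>\<^sub>0 nat) \<Rightarrow> 'b" where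
  "eval_mon s t u v m = s ^ lookup m Var_s * t ^ lookup m Var_t * u ^ lookup m Var_u * v ^ lookup m Var_v"

definition eval_at ::
  "'a::field alg_closure \<Rightarrow> 'a alg_closure \<Rightarrow> 'a alg_closure \<Rightarrow> 'a alg_closure \<Rightarrow> 'a bipoly \<Rightarrow> 'a alg_closure" where
  "eval_at s t u v p = (\<Sum>m\<in>Poly_Mapping.keys p. to_ac (lookup p m) * eval_mon s t u v m)"

lemma eval_at_0 [simp]: "eval_at s t u v 0 = 0"
  by (simp add: eval_at_def)

lemma eval_at_add: "eval_at s t u v (p + q) = eval_at s t u v p + eval_at s t u v q"
  unfolding eval_at_def by (rule setsum_keys_plus_distrib) (simp_all add: algebra_simps)

lemma eval_at_single: "eval_at s t u v (Poly_Mapping.single m c) = to_ac c * eval_mon s t u v m"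
  by (simp add: eval_at_def)

lemma eval_at_mult: "eval_at s t u v (p * q) = eval_at s t u v p * eval_at s t u v q"
proof (induction p rule: bipoly_induct)
  case (single m c)
  show ?case
  proof (induction q rule: bipoly_induct)
    case (single m' c')
    show ?case
      by (simp add: mult_single eval_at_single eval_mon_def lookup_add power_add)
  qed (simp_all add: eval_at_add ring_distribs)
qed (simp_all add: eval_at_add ring_distribs)

lemma eval_at_1 [simp]: "eval_at s t u v 1 = 1"
  by (simp add: eval_at_def eval_mon_def)

lemma eval_at_power: "eval_at s t u v (p ^ k) = eval_at s t u v p ^ k"
  by (induction k) (simp_all add: eval_at_mult)

lemma eval_at_bihom_1:
  assumes "p \<in> bihom 1 n"
  shows "eval_at s t u v p = s * binary_form (coeff (map_poly to_ac (bislice 1 0 n p))) n u v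
    + t * binary_form (coeff (map_poly to_ac (bislice 0 1 n p))) n u v"
proof -
  define A where "A i j = (\<lambda>k. mon i j k (n - k)) ` {..n}" for i j
  have keys: "Poly_Mapping.keys p \<subseteq> A 1 0 \<union> A 0 1"
  proof
    fix m assume m: "m \<in> Poly_Mapping.keys p"
    obtain i j k l where e: "m = mon i j k l" by (rule mon_cases)
    with m have "i + j = 1 \<and> k + l = n"
      using assms unfolding bihom_iff by (auto simp: in_keys_iff)
    then show "m \<in> A 1 0 \<union> A 0 1" by (auto simp: e A_def add_is_1 image_iff)
  qed
  have part: "(\<Sum>m\<in>A i j. to_ac (lookup p m) * eval_mon s t u v m) =
      s ^ i * t ^ j * binary_form (coeff (map_poly to_ac (bislice i j n p))) n u v" for i j
  proof -
    have "inj_on (\<lambda>k. mon i j k (n - k)) {..n}" by (auto simp: inj_on_def)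
    then have "(\<Sum>m\<in>A i j. to_ac (lookup p m) * eval_mon s t u v m) =
        (\<Sum>k\<le>n. to_ac (lookup p (mon i j k (n - k))) * eval_mon s t u v (mon i j k (n - k)))"
      unfolding A_def by (simp add: sum.reindex)
    also have "\<dots> = s ^ i * t ^ j * binary_form (coeff (map_poly to_ac (bislice i j n p))) n u v"
      unfolding binary_form_def sum_distrib_left
      by (rule sum.cong) (auto simp: eval_mon_def coeff_map_poly coeff_bislice)
    finally show ?thesis .
  qed
  have "eval_at s t u v p = (\<Sum>m\<in>A 1 0 \<union> A 0 1. to_ac (lookup p m) * eval_mon s t u v m)"
    unfolding eval_at_def
    by (rule sum.mono_neutral_left[OF _ keys]) (auto simp: A_def in_keys_iff)
  also have "\<dots> = (\<Sum>m\<in>A 1 0. to_ac (lookup p m) * eval_mon s t u v m)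
      + (\<Sum>m\<in>A 0 1. to_ac (lookup p m) * eval_mon s t u v m)"
    by (rule sum.union_disjoint) (auto simp: A_def)
  finally show ?thesis by (simp add: part)
qed

lemma ideal_gen_base: "x \<in> F \<Longrightarrow> x \<in> ideal_gen F"
  and ideal_gen_scale: "x \<in> ideal_gen F \<Longrightarrow> c * x \<in> ideal_gen F"
proof -
  interpret Modules.module "(*) :: 'a::field bipoly \<Rightarrow> 'a bipoly \<Rightarrow> 'a bipoly"
    by unfold_locales (simp_all add: algebra_simps)
  show "x \<in> F \<Longrightarrow> x \<in> ideal_gen F" "x \<in> ideal_gen F \<Longrightarrow> c * x \<in> ideal_gen F"
    unfolding ideal_gen_def by (auto intro: span_base span_scale)
qed

lemma eval_at_ideal_gen:
  assumes "x \<in> ideal_gen F" and "\<And>f. f \<in> F \<Longrightarrow> eval_at s t u v f = 0"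
  shows "eval_at s t u v x = 0"
proof -
  interpret Modules.module "(*) :: 'a::field bipoly \<Rightarrow> 'a bipoly \<Rightarrow> 'a bipoly"
    by unfold_locales (simp_all add: algebra_simps)
  show ?thesis
    using assms(1) unfolding ideal_gen_def
    by (induction rule: span_induct_alt) (simp_all add: eval_at_add eval_at_mult assms(2))
qed

text \<open>The products of one of \<open>s, t\<close> and one of \<open>u, v\<close> lie in both irrelevant ideals, hence in the
  radical, so they vanish at a common zero of the generators.\<close>

lemma basepoint_free_no_common_zero:
  assumes bpf: "basepoint_free F" and zero: "\<And>f. f \<in> F \<Longrightarrow> eval_at s t u v f = 0"
    and uv: "(u, v) \<noteq> (0, 0)"
  shows "(s, t) = (0, 0)"
proof -
  have z: "eval_at s t u v (Xvar x * Xvar y) = 0" if "x \<in> {Var_s, Var_t}" "y \<in> {Var_u, Var_v}" for x y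
  proof -
    have "Xvar x * Xvar y \<in> ideal_gen {Xvar Var_s, Xvar Var_t :: 'a bipoly} \<inter> ideal_gen {Xvar Var_u, Xvar Var_v}"
    proof
      have "Xvar y * Xvar x \<in> ideal_gen {Xvar Var_s, Xvar Var_t :: 'a bipoly}"
        by (intro ideal_gen_scale ideal_gen_base) (use that in auto)
      then show "Xvar x * Xvar y \<in> ideal_gen {Xvar Var_s, Xvar Var_t :: 'a bipoly}"
        by (simp add: mult.commute)
      show "Xvar x * Xvar y \<in> ideal_gen {Xvar Var_u, Xvar Var_v :: 'a bipoly}"
        by (intro ideal_gen_scale ideal_gen_base) (use that in auto)
    qed
    then obtain k where k: "(Xvar x * Xvar y) ^ k \<in> ideal_gen F"
      using bpf unfolding basepoint_free_def radical_def by blast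
    then have "eval_at s t u v ((Xvar x * Xvar y) ^ k) = 0"
      by (rule eval_at_ideal_gen) (rule zero)
    then show ?thesis by (simp add: eval_at_power)
  qed
  have X: "eval_at s t u v (Xvar Var_s) = s" "eval_at s t u v (Xvar Var_t) = t"
    "eval_at s t u v (Xvar Var_u) = u" "eval_at s t u v (Xvar Var_v) = v"
    by (simp_all add: Xvar_def eval_at_single eval_mon_def lookup_single when_def)
  show ?thesis
    using z[of Var_s Var_u] z[of Var_s Var_v] z[of Var_t Var_u] z[of Var_t Var_v] uv
    by (auto simp: eval_at_mult X)
qed

section \<open>Nets of forms of bidegree (1,n) and the Segre variety\<close>

definition comb :: "(3 \<Rightarrow> 'a::field bipoly) \<Rightarrow> 'a^3 \<Rightarrow> 'a bipoly" where
  "comb f x = (\<Sum>i\<in>UNIV. smul (x$i) (f i))"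

lemma bislice_sum: "bislice i j n (sum g S) = (\<Sum>x\<in>S. bislice i j n (g x))"
  by (induction S rule: infinite_finite_induct) auto

lemma bislice_comb: "bislice i j n (comb f x) = lincomb (\<lambda>k. bislice i j n (f k)) x"
  by (simp add: comb_def lincomb_def bislice_sum)

lemma comb_scale: "comb f (c *s x) = smul c (comb f x)"
  by (simp add: comb_def RV.scale_sum_right)

lemma comb_bihom: "(\<And>i. f i \<in> bihom a b) \<Longrightarrow> comb f x \<in> bihom a b"
  unfolding comb_def by (intro bihom_sum bihom_smul)

lemma span_eq_range_comb: "RV.span (range f) = range (comb f)" for f :: "3 \<Rightarrow> 'a::field bipoly"
proof
  have "RV.subspace (range (comb f))"
  proof (rule RV.subspaceI)
    show "0 \<in> range (comb f)" by (rule range_eqI[of _ _ 0]) (simp add: comb_def)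
    show "x + y \<in> range (comb f)" if xy: "x \<in> range (comb f)" "y \<in> range (comb f)" for x y
    proof -
      obtain p q where "x = comb f p" "y = comb f q" using xy by blast
      then have "x + y = comb f (p + q)" by (simp add: comb_def RV.scale_left_distrib sum.distrib)
      then show ?thesis by blast
    qed
    show "smul c x \<in> range (comb f)" if "x \<in> range (comb f)" for c x
      using that by (auto simp flip: comb_scale)
  qed
  moreover have "f i = comb f (axis i 1)" for i
  proof -
    have "comb f (axis i 1) = (\<Sum>j\<in>UNIV. if j = i then f j else 0)"
      unfolding comb_def by (rule sum.cong) (auto simp: axis_def)
    then show ?thesis by simp
  qed
  ultimately show "RV.span (range f) \<subseteq> range (comb f)"
    by (intro RV.span_minimal) auto
  show "range (comb f) \<subseteq> RV.span (range f)"
  proof safe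
    fix x show "comb f x \<in> RV.span (range f)"
      unfolding comb_def by (intro RV.span_sum RV.span_scale RV.span_base) blast
  qed
qed

lemma base_change_comb: "base_change (comb f x) = comb (\<lambda>i. base_change (f i)) (vec_map to_ac x)"
  by (rule poly_mapping_eqI) (simp add: comb_def lookup_sum to_ac_sum)

lemma span_base_change:
  "RV.span (base_change ` RV.span (range f)) = range (comb (\<lambda>i. base_change (f i)))"
  for f :: "3 \<Rightarrow> 'a::field bipoly"
  unfolding span_eq_range_comb[symmetric]
proof (rule antisym)
  show "RV.span (base_change ` RV.span (range f)) \<subseteq> RV.span (range (\<lambda>i. base_change (f i)))"
  proof (rule RV.span_minimal)
    show "base_change ` RV.span (range f) \<subseteq> RV.span (range (\<lambda>i. base_change (f i)))"
      by (auto simp: span_eq_range_comb base_change_comb)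
  qed (rule RV.subspace_span)
  show "RV.span (range (\<lambda>i. base_change (f i))) \<subseteq> RV.span (base_change ` RV.span (range f))"
    by (rule RV.span_mono) (auto intro: RV.span_base)
qed

lemma proj_point_eqD:
  assumes "proj_point p = proj_point q"
  shows "\<exists>c. p = smul c q"
proof -
  have "p \<in> RV.span {q}" using assms RV.span_base[of p "{p}"] by (simp add: proj_point_def)
  then show ?thesis by (auto simp: RV.span_singleton)
qed

text \<open>Both sides say that the coefficients of \<open>s\<close> and \<open>t\<close> in \<open>p\<close> are multiples \<open>q G\<close> and \<open>r G\<close> of
  one form \<open>G\<close>, the linear factor being \<open>q s + r t\<close> and the relation having coefficients \<open>(r, - q)\<close>.\<close>

lemma mem_segre_iff:
  assumes p: "p \<in> bihom 1 n" "p \<noteq> 0"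
  shows "proj_point p \<in> segre n \<longleftrightarrow>
    (\<exists>s t. (s, t) \<noteq> (0, 0) \<and> smult s (bislice 1 0 n p) + smult t (bislice 0 1 n p) = 0)"
proof
  assume "proj_point p \<in> segre n"
  then obtain l g where l: "l \<in> bihom 1 0" "l \<noteq> 0" and "proj_point p = proj_point (l * g)"
    unfolding segre_def by auto
  then obtain c where c: "p = smul c (l * g)" using proj_point_eqD by blast
  obtain q r where qr: "l = linear_st q r" using l(1) by (rule bihom_1_0_cases)
  with l(2) have "(r, - q) \<noteq> (0, 0)" by (auto simp: linear_st_eq_0_iff)
  moreover have "smult r (bislice 1 0 n p) + smult (- q) (bislice 0 1 n p) = 0"
    unfolding c qr bislice_smul bislice_linear_mult by (simp add: mult.commute mult.left_commute)
  ultimately show "\<exists>s t. (s, t) \<noteq> (0, 0) \<and> smult s (bislice 1 0 n p) + smult t (bislice 0 1 n p) = 0"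
    by blast
next
  assume "\<exists>s t. (s, t) \<noteq> (0, 0) \<and> smult s (bislice 1 0 n p) + smult t (bislice 0 1 n p) = 0"
  then obtain s t where st: "(s, t) \<noteq> (0, 0)"
    and rel: "smult s (bislice 1 0 n p) + smult t (bislice 0 1 n p) = 0" by blast
  have "\<exists>G. (\<forall>k>n. coeff G k = 0) \<and> bislice 1 0 n p = smult t G \<and> bislice 0 1 n p = smult (- s) G"
  proof (cases "t = 0")
    case True
    with st have s: "s \<noteq> 0" by simp
    with rel True have "bislice 1 0 n p = 0" by simp
    with True s show ?thesis
      by (intro exI[of _ "smult (- 1 / s) (bislice 0 1 n p)"]) (simp add: coeff_bislice)
  next
    case False
    have "bislice 0 1 n p = smult (- s / t) (bislice 1 0 n p)"
    proof (rule poly_eqI)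
      fix k
      have "s * coeff (bislice 1 0 n p) k + t * coeff (bislice 0 1 n p) k = 0"
        using arg_cong[OF rel, of "\<lambda>q. coeff q k"] by simp
      then show "coeff (bislice 0 1 n p) k = coeff (smult (- s / t) (bislice 1 0 n p)) k"
        using False by (simp add: field_simps eq_neg_iff_add_eq_0)
    qed
    with False show ?thesis
      by (intro exI[of _ "smult (1 / t) (bislice 1 0 n p)"]) (simp add: coeff_bislice)
  qed
  then obtain G where G: "\<And>k. k > n \<Longrightarrow> coeff G k = 0"
    "bislice 1 0 n p = smult t G" "bislice 0 1 n p = smult (- s) G" by blast
  define g where "g = of_slice n G"
  define l where "l = linear_st t (- s)"
  have g: "g \<in> bihom 0 n" and l: "l \<in> bihom 1 0"
    unfolding g_def l_def by (rule of_slice_bihom linear_st_bihom)+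
  have gG: "bislice 0 0 n g = G" unfolding g_def by (rule bislice_of_slice) (rule G(1))
  have "p - l * g = 0"
  proof (rule bihom_zeroI)
    have "l * g \<in> bihom 1 n" using bihom_mult[OF l g] by simp
    then have "p + smul (- 1) (l * g) \<in> bihom 1 n" by (intro bihom_add bihom_smul p)
    then show "p - l * g \<in> bihom 1 n" by (simp add: RV.scale_minus_left)
  next
    fix i j :: nat
    assume "i + j = 1"
    then have "i = 1 \<and> j = 0 \<or> i = 0 \<and> j = 1" by arith
    moreover have "bislice i j n (p - l * g) = bislice i j n p - bislice i j n (l * g)"
      by (rule poly_eqI) (simp add: coeff_bislice lookup_minus)
    ultimately show "bislice i j n (p - l * g) = 0"
      using bislice_linear_mult[of n t "- s" g] by (auto simp: G gG l_def simp del: One_nat_def)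
  qed
  then have plg: "p = l * g" by simp
  with p(2) have "l \<noteq> 0" "g \<noteq> 0" by auto
  with plg l g show "proj_point p \<in> segre n" unfolding segre_def by blast
qed

text \<open>A nontrivial relation would let two of the three generators span.\<close>

lemma comb_injective_of_dim_3:
  assumes dim: "RV.dim (RV.span (range f)) = 3" and x: "comb f x = 0"
  shows "x = 0"
proof (rule ccontr)
  assume "x \<noteq> 0"
  then obtain i where i: "x$i \<noteq> 0" using vec3_neq_0 by blast
  have "smul (x$i) (f i) + (\<Sum>j\<in>UNIV - {i}. smul (x$j) (f j)) = 0"
    using x unfolding comb_def by (simp add: sum.remove[of UNIV i])
  then have "smul (x$i) (f i) = - (\<Sum>j\<in>UNIV - {i}. smul (x$j) (f j))"
    by (simp add: eq_neg_iff_add_eq_0)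
  also have "\<dots> \<in> RV.span (f ` (UNIV - {i}))"
    by (intro RV.span_neg RV.span_sum RV.span_scale RV.span_base) auto
  finally have "smul (x$i) (f i) \<in> RV.span (f ` (UNIV - {i}))" .
  from RV.span_scale[OF this, of "1 / x$i"] have "f i \<in> RV.span (f ` (UNIV - {i}))"
    using i by simp
  then have "range f \<subseteq> RV.span (f ` (UNIV - {i}))"
    by (auto intro: RV.span_base)
  then have "RV.span (range f) \<subseteq> RV.span (f ` (UNIV - {i}))"
    by (rule RV.span_minimal) (rule RV.subspace_span)
  then have "RV.dim (RV.span (range f)) \<le> card (f ` (UNIV - {i}))"
    by (rule RV.dim_le_card) simp
  also have "\<dots> \<le> card (UNIV - {i})" by (rule card_image_le) simp
  also have "\<dots> = 2" by (simp add: card_Diff_singleton)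
  finally show False using dim by simp
qed

text \<open>Coordinates are indexed by the three-element type, so that a member of \<open>W\<close> is the linear
  combination with a coordinate vector.\<close>

locale net =
  fixes f :: "3 \<Rightarrow> 'a::field bipoly" and n :: nat
  assumes n_pos: "n > 0"
    and f_bihom: "\<And>i. f i \<in> bihom 1 n"
    and independent: "\<And>x. comb f x = 0 \<Longrightarrow> x = 0"
    and bpf: "basepoint_free (range f)"
begin

definition \<alpha> where "\<alpha> i = bislice 1 0 n (f i)"
definition \<beta> where "\<beta> i = bislice 0 1 n (f i)"

abbreviation F where "F \<equiv> \<lambda>i. base_change (f i)"

lemma comb_eq_0_iff: "comb f x = 0 \<longleftrightarrow> lincomb \<alpha> x = 0 \<and> lincomb \<beta> x = 0"
proof
  assume "comb f x = 0"
  then show "lincomb \<alpha> x = 0 \<and> lincomb \<beta> x = 0"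
    unfolding \<alpha>_def \<beta>_def bislice_comb[symmetric] by simp
next
  assume z: "lincomb \<alpha> x = 0 \<and> lincomb \<beta> x = 0"
  show "comb f x = 0"
  proof (rule bihom_zeroI[OF comb_bihom[OF f_bihom]])
    fix i j :: nat
    assume "i + j = 1"
    then have "i = 1 \<and> j = 0 \<or> i = 0 \<and> j = 1" by arith
    with z show "bislice i j n (comb f x) = 0"
      by (auto simp: bislice_comb \<alpha>_def[abs_def] \<beta>_def[abs_def])
  qed
qed

lemma bislice_F: "(\<lambda>i. bislice 1 0 n (F i)) = coeffs_to_ac \<alpha>" "(\<lambda>i. bislice 0 1 n (F i)) = coeffs_to_ac \<beta>"
  by (simp_all add: fun_eq_iff coeffs_to_ac_def \<alpha>_def \<beta>_def bislice_base_change)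

sublocale pencil "coeffs_to_ac \<alpha>" "coeffs_to_ac \<beta>" n
proof
  show "0 < n" by (rule n_pos)
  show "x = 0" if "lincomb (coeffs_to_ac \<alpha>) x = 0" "lincomb (coeffs_to_ac \<beta>) x = 0" for x
    using common_kernel_descends[OF _ that] independent comb_eq_0_iff by blast
  show "\<exists>x. s * binary_form (coeff (lincomb (coeffs_to_ac \<alpha>) x)) n u v
      + t * binary_form (coeff (lincomb (coeffs_to_ac \<beta>) x)) n u v \<noteq> 0"
    if st: "(s, t) \<noteq> (0, 0)" and uv: "(u, v) \<noteq> (0, 0)" for s t u v
  proof -
    obtain i where i: "eval_at s t u v (f i) \<noteq> 0"
      using basepoint_free_no_common_zero[OF bpf _ uv, of s t] st by blast
    have a: "lincomb \<gamma> (axis i 1) = \<gamma> i" for \<gamma> :: "3 \<Rightarrow> 'a alg_closure poly"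
    proof -
      have "lincomb \<gamma> (axis i 1) = (\<Sum>j\<in>UNIV. if j = i then \<gamma> j else 0)"
        unfolding lincomb_def by (rule sum.cong) (auto simp: axis_def)
      then show ?thesis by simp
    qed
    show ?thesis
      using i unfolding eval_at_bihom_1[OF f_bihom]
      by (intro exI[of _ "axis i 1"]) (simp add: a coeffs_to_ac_def \<alpha>_def \<beta>_def)
  qed
qed

lemma comb_F_eq_0_iff: "comb F x = 0 \<longleftrightarrow> x = 0"
proof
  assume "comb F x = 0"
  then have "bislice 1 0 n (comb F x) = 0" "bislice 0 1 n (comb F x) = 0" by simp_all
  then show "x = 0" unfolding bislice_comb bislice_F by (rule injective)
qed (simp add: comb_def)

lemma proj_point_comb_eqD:
  assumes "proj_point (comb F x) = proj_point (comb F y)" and "x \<noteq> 0"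
  shows "\<exists>c. c \<noteq> 0 \<and> x = c *s y"
proof -
  obtain c where "comb F x = smul c (comb F y)" using proj_point_eqD[OF assms(1)] by blast
  then have "comb F (x - c *s y) = 0"
    by (simp add: comb_def RV.scale_sum_right RV.scale_left_diff_distrib sum_subtractf)
  then have "x = c *s y" by (simp add: comb_F_eq_0_iff)
  with assms(2) show ?thesis by auto
qed

lemma segre_section:
  "proj_geom (RV.span (range f)) \<inter> segre n = {proj_point (comb F x) | x. x \<noteq> 0 \<and> degenerate x}"
proof -
  have "proj_point (comb F x) \<in> segre n \<longleftrightarrow> degenerate x" if "x \<noteq> 0" for x
  proof -
    have "comb F x \<in> bihom 1 n" by (intro comb_bihom bihom_base_change f_bihom)
    then show ?thesis
      using mem_segre_iff[of "comb F x" n] that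
      unfolding bislice_comb bislice_F degenerate_def by (simp add: comb_F_eq_0_iff)
  qed
  moreover have "proj_geom (RV.span (range f)) = {proj_point (comb F x) | x. x \<noteq> 0}"
  proof -
    have "range (comb F) - {0} = comb F ` {x. x \<noteq> 0}"
      using comb_F_eq_0_iff by fast
    then show ?thesis
      unfolding proj_geom_def proj_space_def span_base_change by (simp add: image_image setcompr_eq_image)
  qed
  ultimately show ?thesis by auto
qed

lemma degenerate_scale: "degenerate x \<Longrightarrow> degenerate (c *s x)"
  unfolding degenerate_def
proof (elim exE conjE, intro exI conjI)
  fix s t assume "smult s (a x) + smult t (b x) = 0"
  then have "smult c (smult s (a x) + smult t (b x)) = 0" by simp
  then show "smult s (a (c *s x)) + smult t (b (c *s x)) = 0"
    by (simp add: smult_add_right mult.commute)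
qed

text \<open>A point of the plane determines its coordinates up to a nonzero factor, and both
  degeneracy and the vanishing of the quadratic form are invariant under scaling.\<close>

lemma section_eq_conic_iff:
  "proj_geom (RV.span (range f)) \<inter> segre n =
      {proj_point (comb F x) | x. x \<noteq> 0 \<and> quad_form_vec p q r d e h x = 0} \<longleftrightarrow>
    (\<forall>x. x \<noteq> 0 \<longrightarrow> degenerate x \<longleftrightarrow> quad_form_vec p q r d e h x = 0)" (is "?L \<longleftrightarrow> ?R")
proof
  have Q: "quad_form_vec p q r d e h (c *s x) = c\<^sup>2 * quad_form_vec p q r d e h x" for c x
    by (simp add: quad_form_vec_def quad_form_def algebra_simps power2_eq_square)
  assume L: ?L
  show ?R
  proof (intro allI impI iffI)
    fix x assume x: "x \<noteq> 0" "degenerate x"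
    then have "proj_point (comb F x) \<in> {proj_point (comb F x) | x. x \<noteq> 0 \<and> quad_form_vec p q r d e h x = 0}"
      unfolding L[symmetric] segre_section by blast
    then obtain y where "proj_point (comb F x) = proj_point (comb F y)" "quad_form_vec p q r d e h y = 0" by auto
    with x(1) obtain c where "x = c *s y" using proj_point_comb_eqD by blast
    with \<open>quad_form_vec p q r d e h y = 0\<close> show "quad_form_vec p q r d e h x = 0" by (simp add: Q)
  next
    fix x assume x: "x \<noteq> 0" "quad_form_vec p q r d e h x = 0"
    then have "proj_point (comb F x) \<in> {proj_point (comb F x) | x. x \<noteq> 0 \<and> degenerate x}"
      unfolding segre_section[symmetric] L by blast
    then obtain y where "proj_point (comb F x) = proj_point (comb F y)" "degenerate y" by blast
    with x(1) show "degenerate x" using proj_point_comb_eqD degenerate_scale by blast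
  qed
next
  assume ?R
  then show ?L unfolding segre_section by blast
qed

text \<open>The two descriptions are transposes of each other: \<open>C\<^sub>j\<close> collects the coefficients of
  \<open>s\<^sup>2\<^sup>-\<^sup>j t\<^sup>j\<close> in the three polynomials of the syzygy, and the four slices of the relation, which has
  bidegree \<open>(3,n)\<close>, are the four conditions on \<open>C\<^sub>0, C\<^sub>1, C\<^sub>2\<close>.\<close>

lemma first_syzygy_iff_quadratic_syzygy:
  "has_first_syzygy_3_n (f 1) (f 2) (f 3) \<longleftrightarrow> (\<exists>C0 C1 C2. quadratic_syzygy \<alpha> \<beta> C0 C1 C2)"
proof -
  have main: "first_syzygy_2_0 (f 1) (f 2) (f 3)
      (quadratic_st (C0$1) (C1$1) (C2$1)) (quadratic_st (C0$2) (C1$2) (C2$2))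
      (quadratic_st (C0$3) (C1$3) (C2$3)) \<longleftrightarrow> quadratic_syzygy \<alpha> \<beta> C0 C1 C2" for C0 C1 C2
  proof -
    define S where "S = quadratic_st (C0$1) (C1$1) (C2$1) * f 1
      + quadratic_st (C0$2) (C1$2) (C2$2) * f 2 + quadratic_st (C0$3) (C1$3) (C2$3) * f 3"
    have "S \<in> bihom (2 + 1) (0 + n)"
      unfolding S_def by (intro bihom_add bihom_mult quadratic_st_bihom f_bihom)
    then have S: "S \<in> bihom 3 n" by simp
    have slices: "bislice 3 0 n S = lincomb \<alpha> C0" "bislice 2 1 n S = lincomb \<beta> C0 + lincomb \<alpha> C1"
      "bislice 1 2 n S = lincomb \<beta> C1 + lincomb \<alpha> C2" "bislice 0 3 n S = lincomb \<beta> C2"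
      unfolding S_def bislice_add bislice_quadratic_mult lincomb_def sum_3 \<alpha>_def \<beta>_def
      by (simp_all add: algebra_simps)
    have "S = 0 \<longleftrightarrow> bislice 3 0 n S = 0 \<and> bislice 2 1 n S = 0 \<and> bislice 1 2 n S = 0 \<and> bislice 0 3 n S = 0"
    proof
      assume z: "bislice 3 0 n S = 0 \<and> bislice 2 1 n S = 0 \<and> bislice 1 2 n S = 0 \<and> bislice 0 3 n S = 0"
      show "S = 0"
      proof (rule bihom_zeroI[OF S])
        fix i j :: nat
        assume "i + j = 3"
        then have "i = 3 \<and> j = 0 \<or> i = 2 \<and> j = 1 \<or> i = 1 \<and> j = 2 \<or> i = 0 \<and> j = 3" by arith
        with z show "bislice i j n S = 0" by blast
      qed
    qed simp
    moreover have "(C0 = 0 \<and> C1 = 0 \<and> C2 = 0) \<longleftrightarrow> (quadratic_st (C0$1) (C1$1) (C2$1) = 0 \<and>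
        quadratic_st (C0$2) (C1$2) (C2$2) = 0 \<and> quadratic_st (C0$3) (C1$3) (C2$3) = 0)"
      by (auto simp: quadratic_st_eq_0_iff vec_eq_iff forall_3)
    ultimately show ?thesis
      unfolding first_syzygy_2_0_def quadratic_syzygy_def slices
      using quadratic_st_bihom S_def by auto
  qed
  show ?thesis
  proof
    assume "has_first_syzygy_3_n (f 1) (f 2) (f 3)"
    then obtain c1 c2 c3 where c: "first_syzygy_2_0 (f 1) (f 2) (f 3) c1 c2 c3"
      unfolding has_first_syzygy_3_n_def by blast
    then have "c1 \<in> bihom 2 0" "c2 \<in> bihom 2 0" "c3 \<in> bihom 2 0"
      unfolding first_syzygy_2_0_def by auto
    then obtain p1 q1 r1 p2 q2 r2 p3 q3 r3 where e: "c1 = quadratic_st p1 q1 r1"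
      "c2 = quadratic_st p2 q2 r2" "c3 = quadratic_st p3 q3 r3"
      by (meson bihom_2_0_cases)
    have "quadratic_syzygy \<alpha> \<beta> (vector [p1, p2, p3]) (vector [q1, q2, q3]) (vector [r1, r2, r3])"
      unfolding main[symmetric] vector_3 using c unfolding e .
    then show "\<exists>C0 C1 C2. quadratic_syzygy \<alpha> \<beta> C0 C1 C2" by blast
  next
    assume "\<exists>C0 C1 C2. quadratic_syzygy \<alpha> \<beta> C0 C1 C2"
    then show "has_first_syzygy_3_n (f 1) (f 2) (f 3)"
      unfolding has_first_syzygy_3_n_def main[symmetric] by blast
  qed
qed

lemma smooth_conic_iff:
  "smooth_conic (f 1) (f 2) (f 3) C \<longleftrightarrow> (\<exists>p q r d e h.
      smooth_form (to_ac p) (to_ac q) (to_ac r) (to_ac d) (to_ac e) (to_ac h) \<and>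
      C = {proj_point (comb F x) | x. x \<noteq> 0 \<and>
        quad_form_vec (to_ac p) (to_ac q) (to_ac r) (to_ac d) (to_ac e) (to_ac h) x = 0})"
proof -
  have "{proj_point (smul x (F 1) + smul y (F 2) + smul z (F 3)) | x y z.
        (x, y, z) \<noteq> (0, 0, 0) \<and> quad_form p q r d e h x y z = 0} =
      {proj_point (comb F x) | x. x \<noteq> 0 \<and> quad_form_vec p q r d e h x = 0}" (is "?A = ?B") for p q r d e h
  proof
    show "?A \<subseteq> ?B"
    proof
      fix P assume "P \<in> ?A"
      then obtain x y z where P: "P = proj_point (smul x (F 1) + smul y (F 2) + smul z (F 3))"
        "(x, y, z) \<noteq> (0, 0, 0)" "quad_form p q r d e h x y z = 0" by blast
      then have "P = proj_point (comb F (vector [x, y, z]))" "vector [x, y, z] \<noteq> (0 :: ('a alg_closure)^3)"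
        "quad_form_vec p q r d e h (vector [x, y, z]) = 0"
        by (auto simp: comb_def sum_3 vector_3 vec_eq_iff forall_3 quad_form_vec_def)
      then show "P \<in> ?B" by blast
    qed
    show "?B \<subseteq> ?A"
      by (fastforce simp: comb_def sum_3 vec_eq_iff forall_3 quad_form_vec_def)
  qed
  then show ?thesis unfolding smooth_conic_def smooth_form_def by simp
qed

lemma smooth_conic_imp_syzygy:
  assumes "smooth_conic (f 1) (f 2) (f 3) (proj_geom (RV.span (range f)) \<inter> segre n)"
  shows "\<exists>C0 C1 C2. quadratic_syzygy \<alpha> \<beta> C0 C1 C2"
proof -
  obtain p q r d e h where smooth: "smooth_form (to_ac p) (to_ac q) (to_ac r) (to_ac d) (to_ac e) (to_ac h)"
    and eq: "\<forall>x. x \<noteq> 0 \<longrightarrow> degenerate x \<longleftrightarrow> quad_form_vec (to_ac p) (to_ac q) (to_ac r) (to_ac d) (to_ac e) (to_ac h) x = 0"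
    using assms unfolding smooth_conic_iff section_eq_conic_iff by blast
  obtain G0 G1 G2 :: "('a alg_closure)^3"
    where ind: "\<And>x y z. x *s G0 + y *s G1 + z *s G2 = 0 \<Longrightarrow> x = 0 \<and> y = 0 \<and> z = 0"
    and on: "\<And>y z. quad_form_vec (to_ac p) (to_ac q) (to_ac r) (to_ac d) (to_ac e) (to_ac h) (quadratic_point G0 G1 G2 y z) = 0"
    using smooth_form_parametrization[OF smooth] by blast
  have "degenerate (0 :: ('a alg_closure)^3)"
    unfolding degenerate_def by (intro exI[of _ 1]) simp
  with eq on have "degenerate (quadratic_point G0 G1 G2 y z)" for y z by metis
  then show ?thesis
    using syzygy_of_degenerate_conic[OF ind] quadratic_syzygy_descends by blast
qed

text \<open>The conic is \<open>\<eta>\<^sup>2 = \<xi> \<zeta>\<close> in the coordinates dual to the coefficient vectors of the syzygy.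
  These vectors form a basis already over the ground field, so the equation has coefficients there.\<close>

lemma syzygy_imp_smooth_conic:
  assumes syz: "quadratic_syzygy \<alpha> \<beta> C0 C1 C2"
  shows "smooth_conic (f 1) (f 2) (f 3) (proj_geom (RV.span (range f)) \<inter> segre n)"
proof -
  let ?C0 = "vec_map to_ac C0" and ?C1 = "vec_map to_ac C1" and ?C2 = "vec_map to_ac C2"
  have syz': "quadratic_syzygy (coeffs_to_ac \<alpha>) (coeffs_to_ac \<beta>) ?C0 ?C1 ?C2"
    by (rule quadratic_syzygy_extends[OF syz])
  note ind = quadratic_syzygy_independent[OF syz']
  have "x = 0 \<and> y = 0 \<and> z = 0" if "x *s C0 + y *s C1 + z *s C2 = 0" for x y z
  proof -
    have "to_ac x *s ?C0 + to_ac y *s ?C1 + to_ac z *s ?C2 = vec_map to_ac (x *s C0 + y *s C1 + z *s C2)"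
      by (simp add: vec_eq_iff)
    also have "\<dots> = 0" unfolding that by (simp add: vec_eq_iff)
    finally show ?thesis using ind by fastforce
  qed
  then have "\<forall>i. \<exists>x y z. axis i 1 = x *s C0 + y *s C1 + z *s C2"
    using independent_triple_spans[of C0 C1 C2] by blast
  then obtain u v w where axes: "\<And>i. axis i 1 = u i *s C0 + v i *s C1 + w i *s C2"
    by metis
  have ax: "(if i = j then 1 else 0) = u j * C0$i + v j * C1$i + w j * C2$i" for i j
    using arg_cong[OF axes[of j], of "\<lambda>x. x$i"] by (simp add: axis_def)
  define \<xi> where "\<xi> x = to_ac (u 1) * x$1 + to_ac (u 2) * x$2 + to_ac (u 3) * x$3" for x :: "('a alg_closure)^3"
  define \<eta> where "\<eta> x = to_ac (v 1) * x$1 + to_ac (v 2) * x$2 + to_ac (v 3) * x$3" for x :: "('a alg_closure)^3"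
  define \<zeta> where "\<zeta> x = to_ac (w 1) * x$1 + to_ac (w 2) * x$2 + to_ac (w 3) * x$3" for x :: "('a alg_closure)^3"
  have dual: "x = \<xi> x *s ?C0 + \<eta> x *s ?C1 + \<zeta> x *s ?C2" for x
  proof -
    have ax': "(if i = j then 1 else 0) =
        to_ac (u j) * to_ac (C0$i) + to_ac (v j) * to_ac (C1$i) + to_ac (w j) * to_ac (C2$i)" for i j
      using arg_cong[OF ax[of i j], of to_ac] by (simp split: if_splits)
    have "(\<xi> x *s ?C0 + \<eta> x *s ?C1 + \<zeta> x *s ?C2) $ i = x$i" for i
    proof -
      have "(\<xi> x *s ?C0 + \<eta> x *s ?C1 + \<zeta> x *s ?C2) $ i =
        (\<Sum>j\<in>UNIV. (to_ac (u j) * to_ac (C0$i) + to_ac (v j) * to_ac (C1$i) + to_ac (w j) * to_ac (C2$i)) * x$j)"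
        by (simp add: \<xi>_def \<eta>_def \<zeta>_def sum_3 algebra_simps)
      also have "\<dots> = (\<Sum>j\<in>UNIV. if j = i then x$j else 0)"
        unfolding ax'[symmetric] by (rule sum.cong) auto
      finally show ?thesis by simp
    qed
    then show ?thesis by (simp add: vec_eq_iff)
  qed
  \<comment> \<open>The six coefficients of \<open>\<eta>\<^sup>2 - \<xi> \<zeta>\<close>, to be fed to the form and to the smoothness predicate.\<close>
  let ?Q = "\<lambda>k. k (to_ac ((v 1)\<^sup>2 - u 1 * w 1)) (to_ac ((v 2)\<^sup>2 - u 2 * w 2)) (to_ac ((v 3)\<^sup>2 - u 3 * w 3))
    (to_ac (2 * v 1 * v 2 - u 1 * w 2 - u 2 * w 1)) (to_ac (2 * v 1 * v 3 - u 1 * w 3 - u 3 * w 1))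
    (to_ac (2 * v 2 * v 3 - u 2 * w 3 - u 3 * w 2))"
  have Q: "?Q quad_form_vec x = (\<eta> x)\<^sup>2 - \<xi> x * \<zeta> x" for x
    unfolding \<xi>_def \<eta>_def \<zeta>_def quad_form_vec_def quad_form_def
    by (simp add: algebra_simps power2_eq_square)
  have "degenerate x \<longleftrightarrow> ?Q quad_form_vec x = 0" for x
    using degenerate_iff_conic[OF syz', of "\<xi> x" "\<eta> x" "\<zeta> x"] unfolding dual[symmetric] Q by simp
  moreover have "?Q smooth_form"
    by (rule smooth_form_of_dual_coordinates[OF dual ind Q])
  ultimately show ?thesis
    unfolding smooth_conic_iff section_eq_conic_iff by blast
qed

theorem smooth_conic_iff_first_syzygy:
  "smooth_conic (f 1) (f 2) (f 3) (proj_geom (RV.span (range f)) \<inter> segre n) \<longleftrightarrow>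
    has_first_syzygy_3_n (f 1) (f 2) (f 3)"
  using smooth_conic_imp_syzygy syzygy_imp_smooth_conic first_syzygy_iff_quadratic_syzygy by blast

end

section \<open>The smooth conic criterion\<close>

theorem theorem4p4:
  fixes n :: nat and W :: "'a::field bipoly set" and f0 f1 f2 :: "'a bipoly"
  assumes "n > 0"
    and "W \<subseteq> bihom 1 n"
    and "RV.dim W = 3"
    and "W = RV.span {f0, f1, f2}"
    and "basepoint_free {f0, f1, f2}"
  shows "smooth_conic f0 f1 f2 (proj_geom W \<inter> segre n) \<longleftrightarrow> has_first_syzygy_3_n f0 f1 f2"
proof -
  define f :: "3 \<Rightarrow> 'a bipoly" where "f i = (if i = 1 then f0 else if i = 2 then f1 else f2)" for i
  have f: "f 1 = f0" "f 2 = f1" "f 3 = f2" by (simp_all add: f_def)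
  have range: "range f = {f0, f1, f2}"
    using exhaust_3 f by (auto simp: image_iff) (metis f_def)+
  interpret net f n
  proof
    show "0 < n" by fact
    show "f i \<in> bihom 1 n" for i
    proof -
      have "f i \<in> W" using RV.span_base[of "f i" "range f"] unfolding assms(4) range[symmetric] by simp
      with assms(2) show ?thesis by blast
    qed
    show "x = 0" if "comb f x = 0" for x
      using comb_injective_of_dim_3[OF _ that] assms(3,4) range by simp
    show "basepoint_free (range f)" using assms(5) range by simp
  qed
  show ?thesis
    using smooth_conic_iff_first_syzygy unfolding f range assms(4) .
qed

end
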